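(* Let $m\ge 1$ and $N\ge 1$ be integers, $h=1/N$, and let $z\in[0,1]$. There exists a unique lattice optimal interpolation formula in $\widetilde{L_2^{(m)}}(0,1)$ with nodes $x_\beta=h\beta$, $\beta=1,\dots,N$; that is, among all real vectors $(C([1];z),\dots,C([N];z))$ with $\sum_{\beta=1}^N C([\beta];z)=1$ there is exactly one minimizing $\|\ell\,|\,\widetilde{L_2^{(m)*}}(0,1)\|$. Its coefficients are $$\stackrel{\circ}{C}([\beta];z)=h\left(1+\sum_{k\in\mathbb{Z},\ kh\notin\mathbb{Z}}\frac{\exp(2\pi i k(h\beta-z))}{k^{2m}}\,L(k)\right),\qquad \beta=1,\dots,N,$$ where $$L(k)=\left(\sum_{\gamma\in\mathbb{Z}}\frac{h^{2m}}{|\gamma-hk|^{2m}}\right)^{-1}.$$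
   Context: $\widetilde{L_2^{(m)}}(0,1)$ is the Hilbert space of real 1-periodic functions $\varphi$ on $\mathbb{R}$ with locally summable derivatives up to order $m$ and $\int_0^1(\varphi^{(m)}(x))^2dx<\infty$, where functions differing by a constant are identified, with norm $\|\varphi\|=\left(\int_0^1(\varphi^{(m)}(x))^2dx\right)^{1/2}$. Write $[\beta]=h\beta$. For fixed $z$, the interpolation formula $\varphi(z)\cong\sum_{\beta=1}^N C([\beta];z)\varphi(h\beta)$ has error functional $$(\ell,\varphi)=\varphi(z)-\sum_{\beta=1}^N C([\beta];z)\varphi(h\beta).$$ It is required that $(\ell,1)=0$, i.e. $\sum_{\beta=1}^N C([\beta];z)=1$, so that $\ell$ is well defined on the space and belongs to the dual space $\widetilde{L_2^{(m)*}}(0,1)$, with norm $\|\ell\,|\,\widetilde{L_2^{(m)*}}(0,1)\|=\sup_{\|\varphi\|=1}|(\ell,\varphi)|$. The formula is called (lattice) optimal if its coefficients minimize this norm for the given nodes. *)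

theory Defs
  imports "HOL-Analysis.Analysis" "HOL-Library.FuncSet"
begin

text \<open>Generalized derivatives in Sobolev's sense, expressed through the (unique) continuous
  representative, since the interpolation formula evaluates functions at points:
  \<open>g\<close> is a first generalized derivative of \<open>f\<close> if it is locally summable and \<open>f\<close> is an
  indefinite Lebesgue integral of it.\<close>

definition has_gen_deriv :: "(real \<Rightarrow> real) \<Rightarrow> (real \<Rightarrow> real) \<Rightarrow> bool" where
  "has_gen_deriv f g \<longleftrightarrow>
     (\<forall>a b. a \<le> b \<longrightarrow> g absolutely_integrable_on {a..b} \<and> integral {a..b} g = f b - f a)"

fun has_gen_deriv_n :: "nat \<Rightarrow> (real \<Rightarrow> real) \<Rightarrow> (real \<Rightarrow> real) \<Rightarrow> bool" where
  "has_gen_deriv_n 0 f g \<longleftrightarrow> g = f"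
| "has_gen_deriv_n (Suc n) f g \<longleftrightarrow> (\<exists>f'. has_gen_deriv f f' \<and> has_gen_deriv_n n f' g)"

text \<open>For \<open>m \<ge> 1\<close> the \<open>m\<close>-th generalized derivative is determined up to a null set, so integrals
  of expressions in it do not depend on the choice made here.\<close>

definition gen_deriv :: "nat \<Rightarrow> (real \<Rightarrow> real) \<Rightarrow> real \<Rightarrow> real" where
  "gen_deriv m f = (SOME g. has_gen_deriv_n m f g)"

text \<open>The representatives of the elements of the periodic Sobolev space. Functions differing by a
  constant represent the same element; accordingly \<open>periodic_norm\<close> is invariant under adding
  constants, and so is every functional vanishing on constants.\<close>

definition periodic_L2 :: "nat \<Rightarrow> (real \<Rightarrow> real) set" where
  "periodic_L2 m = {\<phi>. (\<forall>x. \<phi> (x + 1) = \<phi> x) \<and> (\<exists>g. has_gen_deriv_n m \<phi> g) \<and>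
     (\<lambda>x. (gen_deriv m \<phi> x)\<^sup>2) absolutely_integrable_on {0..1}}"

definition periodic_norm :: "nat \<Rightarrow> (real \<Rightarrow> real) \<Rightarrow> real" where
  "periodic_norm m \<phi> = sqrt (integral {0..1} (\<lambda>x. (gen_deriv m \<phi> x)\<^sup>2))"

definition error_functional :: "nat \<Rightarrow> real \<Rightarrow> (nat \<Rightarrow> real) \<Rightarrow> (real \<Rightarrow> real) \<Rightarrow> real" where
  "error_functional N z C \<phi> = \<phi> z - (\<Sum>\<beta>=1..N. C \<beta> * \<phi> (1 / real N * real \<beta>))"

text \<open>Taken in the extended reals, so that the supremum has its usual meaning without a prior
  proof of boundedness.\<close>

definition dual_norm :: "nat \<Rightarrow> ((real \<Rightarrow> real) \<Rightarrow> real) \<Rightarrow> ereal" where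
  "dual_norm m l = (SUP \<phi>\<in>{\<phi> \<in> periodic_L2 m. periodic_norm m \<phi> = 1}. ereal \<bar>l \<phi>\<bar>)"

definition lattice_optimal :: "nat \<Rightarrow> nat \<Rightarrow> real \<Rightarrow> (nat \<Rightarrow> real) \<Rightarrow> bool" where
  "lattice_optimal m N z C \<longleftrightarrow>
     is_arg_min (\<lambda>C. dual_norm m (error_functional N z C)) (\<lambda>C. (\<Sum>\<beta>=1..N. C \<beta>) = 1) C"

definition L_factor :: "nat \<Rightarrow> real \<Rightarrow> int \<Rightarrow> real" where
  "L_factor m h k =
     inverse (\<Sum>\<^sub>\<infinity>\<gamma>\<in>(UNIV :: int set). h ^ (2 * m) / \<bar>of_int \<gamma> - h * of_int k\<bar> ^ (2 * m))"

end

(* The norm of a functional vanishing on constants is the L2 norm of its representer, a combination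
   of translates of the periodic Green function (Bernoulli kernel) of order m; its potential is the
   same combination of translates of the kernel of order 2m. A formula is optimal as soon as the
   potential of its error functional is constant on the lattice: perturbing the coefficients then
   adds an orthogonal nonzero representer. Splitting the Fourier series of the kernel of order 2m
   into residue classes modulo N turns this condition into a finite discrete Fourier transform. *)

theory Submission imports Defs begin

section \<open>Generalized derivatives\<close>

text \<open>The kernel of order \<open>m\<close> is discontinuous when \<open>m = 1\<close>, and its
  Fourier series then converges only conditionally. Termwise integration under a majorant fails
  there, so \<open>green 1\<close> is a closed form, linked to \<open>green 2\<close> by Abel
  summation; the potential, of order \<open>2 * m \<ge> 2\<close>, causes no such trouble. Top
  derivatives are merely integrable and fixed up to null sets, so integration by parts and
  uniqueness are proved for indefinite integrals. A constant potential suffices because admissible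
  perturbations live on the lattice and have total weight zero, hence annihilate constants; their
  representers are nonzero because cosines separate lattice functionals. The finite Fourier
  transform applies because frequencies congruent modulo \<open>N\<close> alias: a lattice shift
  multiplies a whole class by one root of unity. Dividing class \<open>r\<close> at \<open>z\<close>
  by class \<open>r\<close> at \<open>0\<close> dictates the coefficients, class \<open>0\<close> is
  left to the condition of total weight one, and \<open>L(k)\<close> is the reciprocal of the class
  sum at \<open>0\<close>.\<close>

lemma integral_abs_eq_0_of_subintervals:
  fixes g :: "real \<Rightarrow> real"
  assumes g: "g absolutely_integrable_on {a..b}"
    and zero: "\<And>c d. a \<le> c \<Longrightarrow> c \<le> d \<Longrightarrow> d \<le> b \<Longrightarrow> integral {c..d} g = 0"
  shows "integral {a..b} (\<lambda>x. \<bar>g x\<bar>) = 0"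
proof -
  have gi: "g integrable_on cbox a b" and ai: "(\<lambda>x. \<bar>g x\<bar>) integrable_on cbox a b"
    using g by (auto simp: absolutely_integrable_on_def)
  have "integral {a..b} (\<lambda>x. \<bar>g x\<bar>) \<le> e" if e: "e > 0" for e
  proof -
    \<comment> \<open>Henstock's lemma bounds the sum of the absolute deviations over the cells, not
      just the absolute value of their sum. Since every cell integral of \<open>g\<close> vanishes,
      that sum is a Riemann sum of \<open>\<bar>g x\<bar>\<close>.\<close>
    obtain \<gamma>1 where \<gamma>1: "gauge \<gamma>1"
      "\<And>p. \<lbrakk>p tagged_partial_division_of (cbox a b); \<gamma>1 fine p\<rbrakk> \<Longrightarrow>
             sum (\<lambda>(x,k). norm(measure lborel k *\<^sub>R g x - integral k g)) p < e/2"
      by (rule Henstock_lemma[OF gi half_gt_zero[OF e]]) (rule that)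
    obtain \<gamma>2 where \<gamma>2: "gauge \<gamma>2"
      "\<And>p. p tagged_division_of (cbox a b) \<Longrightarrow> \<gamma>2 fine p \<Longrightarrow>
         norm ((\<Sum>(x,K)\<in>p. measure lborel K *\<^sub>R \<bar>g x\<bar>) - integral (cbox a b) (\<lambda>x. \<bar>g x\<bar>)) < e/2"
    proof -
      have "\<exists>\<gamma>. gauge \<gamma> \<and> (\<forall>p. p tagged_division_of (cbox a b) \<and> \<gamma> fine p \<longrightarrow>
         norm ((\<Sum>(x,K)\<in>p. measure lborel K *\<^sub>R \<bar>g x\<bar>) - integral (cbox a b) (\<lambda>x. \<bar>g x\<bar>)) < e/2)"
        by (rule integrable_integral[OF ai, unfolded has_integral, rule_format, OF half_gt_zero[OF e]])
      then show ?thesis using that by (elim exE conjE) simp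
    qed
    obtain p where p: "p tagged_division_of (cbox a b)" "(\<lambda>x. \<gamma>1 x \<inter> \<gamma>2 x) fine p"
      by (rule fine_division_exists[OF gauge_Int[OF \<gamma>1(1) \<gamma>2(1)]]) (rule that)
    have "(\<Sum>(x,K)\<in>p. measure lborel K *\<^sub>R \<bar>g x\<bar>) = sum (\<lambda>(x,k). norm(measure lborel k *\<^sub>R g x - integral k g)) p"
    proof (rule sum.cong[OF refl], clarify)
      fix x K assume xK: "(x, K) \<in> p"
      obtain c d where K: "K = cbox c d"
        using tagged_division_ofD(4)[OF p(1) xK] by blast
      have "x \<in> {c..d}" "{c..d} \<subseteq> {a..b}"
        using tagged_division_ofD(2,3)[OF p(1) xK] unfolding K cbox_interval by blast+
      then have "a \<le> c" "c \<le> d" "d \<le> b" by simp_all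
      then have "integral K g = 0"
        unfolding K cbox_interval by (rule zero)
      then show "measure lborel K *\<^sub>R \<bar>g x\<bar> = norm (measure lborel K *\<^sub>R g x - integral K g)"
        by (simp add: abs_mult)
    qed
    also have "\<dots> < e/2"
      using p by (intro \<gamma>1(2)) (auto simp: tagged_division_of_def fine_Int)
    finally have "(\<Sum>(x,K)\<in>p. measure lborel K *\<^sub>R \<bar>g x\<bar>) < e/2" .
    moreover have "norm ((\<Sum>(x,K)\<in>p. measure lborel K *\<^sub>R \<bar>g x\<bar>) - integral (cbox a b) (\<lambda>x. \<bar>g x\<bar>)) < e/2"
      using p by (intro \<gamma>2(2)) (auto simp: fine_Int)
    ultimately show ?thesis
      unfolding cbox_interval real_norm_def by linarith
  qed
  then have "integral {a..b} (\<lambda>x. \<bar>g x\<bar>) \<le> 0"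
    by (rule field_le_epsilon) simp
  moreover have "0 \<le> integral {a..b} (\<lambda>x. \<bar>g x\<bar>)"
    using integral_nonneg[OF ai] by simp
  ultimately show ?thesis by linarith
qed

text \<open>The difference has zero integral over all subintervals, hence zero \<open>L1\<close>
  norm. It is meant for two \<open>m\<close>-th generalized derivatives of one function.\<close>

lemma AE_eq_of_subinterval_integrals:
  fixes f g :: "real \<Rightarrow> real"
  assumes f: "f absolutely_integrable_on {a..b}" and g: "g absolutely_integrable_on {a..b}"
    and eq: "\<And>c d. a \<le> c \<Longrightarrow> c \<le> d \<Longrightarrow> d \<le> b \<Longrightarrow> integral {c..d} f = integral {c..d} g"
  obtains S where "negligible S" "\<And>x. x \<in> {a..b} - S \<Longrightarrow> f x = g x"
proof -
  let ?d = "\<lambda>x. \<bar>f x - g x\<bar>"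
  have d: "(\<lambda>x. f x - g x) absolutely_integrable_on {a..b}"
    using f g by (rule set_integral_diff)
  have "integral {a..b} ?d = 0"
  proof (rule integral_abs_eq_0_of_subintervals[OF d])
    fix c d assume "a \<le> c" "c \<le> d" "d \<le> b"
    then have "f integrable_on {c..d}" "g integrable_on {c..d}"
      using f g by (auto simp: absolutely_integrable_on_def intro!: integrable_on_subinterval)
    then show "integral {c..d} (\<lambda>x. f x - g x) = 0"
      using eq[of c d] \<open>a \<le> c\<close> \<open>c \<le> d\<close> \<open>d \<le> b\<close> by (simp add: Henstock_Kurzweil_Integration.integral_diff)
  qed
  moreover have ad: "?d absolutely_integrable_on {a..b}"
    using d by (rule set_integrable_abs)
  ultimately have "set_lebesgue_integral lebesgue {a..b} ?d = 0"
    by (simp add: set_lebesgue_integral_eq_integral(2))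
  then have "AE x in lebesgue. indicator {a..b} x *\<^sub>R ?d x = 0"
    using ad integral_nonneg_eq_0_iff_AE[of lebesgue "\<lambda>x. indicator {a..b} x *\<^sub>R ?d x"]
    by (auto simp: set_lebesgue_integral_def set_integrable_def)
  then obtain S where "S \<in> null_sets lebesgue" "{x. \<not> (indicator {a..b} x *\<^sub>R ?d x = 0)} \<subseteq> S"
    by (auto simp: eventually_ae_filter)
  then show ?thesis
    by (intro that[of S]) (auto simp: negligible_iff_null_sets indicator_def)
qed

lemma has_gen_deriv_abs_int: "has_gen_deriv f g \<Longrightarrow> g absolutely_integrable_on {a..b}"
  unfolding has_gen_deriv_def by (cases "a \<le> b") (blast, simp)

lemma has_gen_deriv_integral: "has_gen_deriv f g \<Longrightarrow> a \<le> b \<Longrightarrow> integral {a..b} g = f b - f a"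
  unfolding has_gen_deriv_def by blast

lemma has_gen_deriv_continuous_on:
  assumes "has_gen_deriv f g" shows "continuous_on {a..b} f"
proof (cases "a \<le> b")
  case True
  have "continuous_on {a..b} (\<lambda>x. integral {a..x} g)"
    using has_gen_deriv_abs_int[OF assms] indefinite_integral_continuous_1
    by (metis absolutely_integrable_on_def)
  then have "continuous_on {a..b} (\<lambda>x. f a + integral {a..x} g)"
    by (intro continuous_intros)
  then show ?thesis
    by (rule continuous_on_eq) (use has_gen_deriv_integral[OF assms] in auto)
qed auto

lemma has_gen_deriv_continuous:
  assumes "has_gen_deriv f g" shows "continuous_on UNIV f"
proof -
  have "isCont f x" for x
    using continuous_on_interior[OF has_gen_deriv_continuous_on[OF assms, of "x-1" "x+1"], of x] by auto
  then show ?thesis by (simp add: continuous_at_imp_continuous_on)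
qed

lemma has_gen_deriv_DERIV:
  assumes f: "has_gen_deriv f g" and g: "continuous_on UNIV g"
  shows "(f has_real_derivative g x) (at x)"
proof -
  have "continuous_on {x-1..x+1} g"
    using g by (rule continuous_on_subset) simp
  then have "((\<lambda>u. integral {x-1..u} g) has_real_derivative g x) (at x within {x-1..x+1})"
    by (rule integral_has_real_derivative) simp
  then have "((\<lambda>u. f (x-1) + integral {x-1..u} g) has_real_derivative 0 + g x) (at x within {x-1..x+1})"
    by (intro DERIV_add DERIV_const)
  then have "(f has_real_derivative 0 + g x) (at x within {x-1..x+1})"
    by (rule has_field_derivative_transform_within[where d = 1])
       (simp_all add: has_gen_deriv_integral[OF f])
  moreover have "at x within {x-1..x+1} = at x"
    by (rule at_within_interior) simp
  ultimately show ?thesis by simp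
qed

lemma DERIV_imp_has_gen_deriv:
  assumes "\<And>x. (f has_real_derivative g x) (at x)" and "continuous_on UNIV g"
  shows "has_gen_deriv f g"
  unfolding has_gen_deriv_def
proof (intro allI impI conjI)
  fix a b :: real assume "a \<le> b"
  show "g absolutely_integrable_on {a..b}"
    using assms(2) by (meson absolutely_integrable_continuous_real continuous_on_subset subset_UNIV)
  have "(g has_integral (f b - f a)) {a..b}"
    using \<open>a \<le> b\<close> assms(1)
    by (intro fundamental_theorem_of_calculus)
       (auto intro: has_field_derivative_at_within simp flip: has_real_derivative_iff_has_vector_derivative)
  then show "integral {a..b} g = f b - f a" by blast
qed

lemma has_gen_deriv_add:
  assumes "has_gen_deriv f f'" "has_gen_deriv g g'"
  shows "has_gen_deriv (\<lambda>x. f x + g x) (\<lambda>x. f' x + g' x)"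
  unfolding has_gen_deriv_def
proof (intro allI impI conjI)
  fix a b :: real assume "a \<le> b"
  note ai = has_gen_deriv_abs_int[OF assms(1), of a b] has_gen_deriv_abs_int[OF assms(2), of a b]
  show "(\<lambda>x. f' x + g' x) absolutely_integrable_on {a..b}"
    using ai by (rule set_integral_add)
  show "integral {a..b} (\<lambda>x. f' x + g' x) = f b + g b - (f a + g a)"
    using ai has_gen_deriv_integral[OF assms(1) \<open>a \<le> b\<close>] has_gen_deriv_integral[OF assms(2) \<open>a \<le> b\<close>]
    by (simp add: Henstock_Kurzweil_Integration.integral_add absolutely_integrable_on_def)
qed

lemma has_gen_deriv_cmult:
  assumes "has_gen_deriv f f'"
  shows "has_gen_deriv (\<lambda>x. c * f x) (\<lambda>x. c * f' x)"
  unfolding has_gen_deriv_def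
proof (intro allI impI conjI)
  fix a b :: real assume "a \<le> b"
  show "(\<lambda>x. c * f' x) absolutely_integrable_on {a..b}"
    using has_gen_deriv_abs_int[OF assms] by (rule set_integrable_mult_right)
  show "integral {a..b} (\<lambda>x. c * f' x) = c * f b - c * f a"
    by (simp add: has_gen_deriv_integral[OF assms \<open>a \<le> b\<close>] right_diff_distrib)
qed

text \<open>Representers are built from the kernel as a function of \<open>t\<close> in
  \<open>green s (x - t)\<close>; every differentiation in \<open>t\<close> costs a sign.\<close>

lemma has_gen_deriv_reflect:
  assumes "has_gen_deriv f f'"
  shows "has_gen_deriv (\<lambda>t. f (x - t)) (\<lambda>t. - f' (x - t))"
  unfolding has_gen_deriv_def
proof (intro allI impI conjI)
  fix a b :: real assume "a \<le> b"
  have refl: "((\<lambda>t. g (x - t)) has_integral I) {a..b}" if "(g has_integral I) {x-b..x-a}"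
    for g :: "real \<Rightarrow> real" and I
  proof -
    have "((\<lambda>t. g (-1 *\<^sub>R t + x)) has_integral 1 *\<^sub>R I) ((\<lambda>t. (1 / -1) *\<^sub>R t + - ((1 / -1) *\<^sub>R x)) ` cbox (x-b) (x-a))"
      using has_integral_affinity[of g I "x-b" "x-a" "-1" x] that by simp
    moreover have "(\<lambda>t. (1 / -1) *\<^sub>R t + - ((1 / -1) *\<^sub>R x)) ` cbox (x-b) (x-a) = {a..b}"
      using \<open>a \<le> b\<close> by (auto simp: image_iff intro!: bexI[of _ "x - _"])
    ultimately show ?thesis by (simp add: algebra_simps)
  qed
  have refl_int: "(\<lambda>t. g (x - t)) integrable_on {a..b}" if "g integrable_on {x-b..x-a}" for g :: "real \<Rightarrow> real"
    by (rule has_integral_integrable[OF refl[OF integrable_integral[OF that]]])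
  have f': "f' integrable_on {x-b..x-a}" "(\<lambda>t. norm (f' t)) integrable_on {x-b..x-a}"
    using has_gen_deriv_abs_int[OF assms] by (auto simp: absolutely_integrable_on_def)
  have "(\<lambda>t. f' (x - t)) integrable_on {a..b}" "(\<lambda>t. norm (f' (x - t))) integrable_on {a..b}"
    using refl_int[OF f'(1)] refl_int[OF f'(2)] by simp_all
  then show "(\<lambda>t. - f' (x - t)) absolutely_integrable_on {a..b}"
    by (simp add: absolutely_integrable_on_def integrable_neg)
  have "integral {x-b..x-a} f' = f (x-a) - f (x-b)"
    using has_gen_deriv_integral[OF assms, of "x-b" "x-a"] \<open>a \<le> b\<close> by simp
  then show "integral {a..b} (\<lambda>t. - f' (x - t)) = f (x - b) - f (x - a)"
    using refl[OF integrable_integral[OF f'(1)]] by (simp add: integral_unique)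
qed

text \<open>The defect of the formula over \<open>[s, t]\<close> is at most \<open>e\<close> times the integral of
  \<open>\<bar>f'\<bar> + \<bar>g'\<bar>\<close> over \<open>[s, t]\<close> when \<open>f\<close> and \<open>g\<close> oscillate by less than \<open>e\<close>
  there; both sides are additive in the interval, so this local bound globalizes.\<close>

lemma has_gen_deriv_by_parts:
  assumes f: "has_gen_deriv f f'" and g: "has_gen_deriv g g'" and "a \<le> b"
  shows "integral {a..b} (\<lambda>t. f' t * g t) + integral {a..b} (\<lambda>t. f t * g' t) = f b * g b - f a * g a"
proof -
  have prod: "(\<lambda>t. u t * v' t) absolutely_integrable_on {s..t}"
    if "has_gen_deriv u u'" "has_gen_deriv v v'" for u u' v v' :: "real \<Rightarrow> real" and s t
  proof (rule absolutely_integrable_bounded_measurable_product_real)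
    have c: "continuous_on {s..t} u" using has_gen_deriv_continuous_on that(1) .
    show "u \<in> borel_measurable (lebesgue_on {s..t})"
      using c by (rule continuous_imp_measurable_on_sets_lebesgue) auto
    show "bounded (u ` {s..t})"
      using c by (intro compact_imp_bounded compact_continuous_image) auto
  qed (use has_gen_deriv_abs_int[OF that(2)] in auto)
  have p: "(\<lambda>t. f' t * g t) integrable_on {s..t}" "(\<lambda>t. f t * g' t) integrable_on {s..t}" for s t
    using prod[OF g f, of s t] prod[OF f g, of s t]
    by (auto simp: absolutely_integrable_on_def mult.commute)
  have fi: "f' integrable_on {s..t}" "(\<lambda>t. \<bar>f' t\<bar>) integrable_on {s..t}"
    and gi: "g' integrable_on {s..t}" "(\<lambda>t. \<bar>g' t\<bar>) integrable_on {s..t}" for s t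
    using has_gen_deriv_abs_int[OF f, of s t] has_gen_deriv_abs_int[OF g, of s t]
    by (auto simp: absolutely_integrable_on_def)
  define I where "I s t = integral {s..t} (\<lambda>t. f' t * g t) + integral {s..t} (\<lambda>t. f t * g' t)
    - (f t * g t - f s * g s)" for s t
  define M where "M s t = integral {s..t} (\<lambda>t. \<bar>f' t\<bar> + \<bar>g' t\<bar>)" for s t
  have I_add: "I s t + I t u = I s u" and M_add: "M s t + M t u = M s u" if "s \<le> t" "t \<le> u" for s t u
  proof -
    note c = Henstock_Kurzweil_Integration.integral_combine[OF that]
    show "I s t + I t u = I s u"
      using c[OF p(1)] c[OF p(2)] by (simp add: I_def)
    show "M s t + M t u = M s u"
      using c[OF integrable_add[OF fi(2) gi(2)]] by (simp add: M_def)
  qed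
  have "\<bar>I a b\<bar> \<le> e * M a b" if "e > 0" for e
    using \<open>a \<le> b\<close>
  proof (induction rule: Bolzano)
    case (trans s t u)
    have "\<bar>I s u\<bar> \<le> \<bar>I s t\<bar> + \<bar>I t u\<bar>"
      using I_add[OF trans(3,4)] by linarith
    also have "\<dots> \<le> e * M s t + e * M t u"
      using trans(1,2) by linarith
    also have "\<dots> = e * M s u"
      using M_add[OF trans(3,4)] by (metis distrib_left)
    finally show ?case .
  next
    case (local x)
    have "isCont f x" "isCont g x"
      using has_gen_deriv_continuous f g continuous_on_eq_continuous_at[OF open_UNIV] by blast+
    then have "\<exists>d1>0. \<forall>y. \<bar>y - x\<bar> < d1 \<longrightarrow> \<bar>f y - f x\<bar> < e/2"
      "\<exists>d2>0. \<forall>y. \<bar>y - x\<bar> < d2 \<longrightarrow> \<bar>g y - g x\<bar> < e/2"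
      using half_gt_zero[OF that] unfolding continuous_at_eps_delta dist_real_def by blast+
    then obtain d1 d2 where d: "d1 > 0" "\<And>y. \<bar>y - x\<bar> < d1 \<Longrightarrow> \<bar>f y - f x\<bar> < e/2"
       "d2 > 0" "\<And>y. \<bar>y - x\<bar> < d2 \<Longrightarrow> \<bar>g y - g x\<bar> < e/2"
      by metis
    show ?case
    proof (intro exI[of _ "min d1 d2"] conjI allI impI)
      fix s t assume st: "s \<le> x \<and> x \<le> t \<and> t - s < min d1 d2"
      then have "s \<le> t" by simp
      have osc: "\<bar>g y - g t\<bar> \<le> e" "\<bar>f y - f s\<bar> \<le> e" if "y \<in> {s..t}" for y
      proof -
        have "\<bar>y - x\<bar> < d1" "\<bar>s - x\<bar> < d1" "\<bar>y - x\<bar> < d2" "\<bar>t - x\<bar> < d2"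
          using that st by auto
        from d(2)[OF this(1)] d(2)[OF this(2)] d(4)[OF this(3)] d(4)[OF this(4)]
        show "\<bar>g y - g t\<bar> \<le> e" "\<bar>f y - f s\<bar> \<le> e" by linarith+
      qed
      have "integral {s..t} (\<lambda>y. g t * f' y) = g t * (f t - f s)"
           "integral {s..t} (\<lambda>y. f s * g' y) = f s * (g t - g s)"
        using has_gen_deriv_integral[OF f \<open>s \<le> t\<close>] has_gen_deriv_integral[OF g \<open>s \<le> t\<close>] by simp_all
      \<comment> \<open>Freezing \<open>g\<close> at the right end and \<open>f\<close> at the left
        end splits the increment of the product exactly, with no second-order term, so only
        oscillations against \<open>f'\<close> and \<open>g'\<close> remain.\<close>
      moreover have "f t * g t - f s * g s = g t * (f t - f s) + f s * (g t - g s)"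
        by (simp add: algebra_simps)
      ultimately have "I s t = integral {s..t} (\<lambda>y. f' y * g y) - integral {s..t} (\<lambda>y. g t * f' y)
        + (integral {s..t} (\<lambda>y. f y * g' y) - integral {s..t} (\<lambda>y. f s * g' y))"
        unfolding I_def by linarith
      also have "\<dots> = integral {s..t} (\<lambda>y. f' y * g y - g t * f' y) + integral {s..t} (\<lambda>y. f y * g' y - f s * g' y)"
        by (simp only: Henstock_Kurzweil_Integration.integral_diff[OF p(1) integrable_on_mult_right[OF fi(1)]]
            Henstock_Kurzweil_Integration.integral_diff[OF p(2) integrable_on_mult_right[OF gi(1)]])
      also have "\<dots> = integral {s..t} (\<lambda>y. f' y * g y - g t * f' y + (f y * g' y - f s * g' y))"
        by (rule Henstock_Kurzweil_Integration.integral_add[OF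
          integrable_diff[OF p(1) integrable_on_mult_right[OF fi(1)]]
          integrable_diff[OF p(2) integrable_on_mult_right[OF gi(1)]], symmetric])
      also have "\<bar>\<dots>\<bar> \<le> integral {s..t} (\<lambda>y. e * (\<bar>f' y\<bar> + \<bar>g' y\<bar>))"
      proof (rule integral_norm_bound_integral[where 'a = real, unfolded real_norm_def])
        show "(\<lambda>y. f' y * g y - g t * f' y + (f y * g' y - f s * g' y)) integrable_on {s..t}"
          by (rule integrable_add[OF integrable_diff[OF p(1) integrable_on_mult_right[OF fi(1)]]
             integrable_diff[OF p(2) integrable_on_mult_right[OF gi(1)]]])
        show "(\<lambda>y. e * (\<bar>f' y\<bar> + \<bar>g' y\<bar>)) integrable_on {s..t}"
          by (rule integrable_on_mult_right[OF integrable_add[OF fi(2) gi(2)]])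
        fix y assume y: "y \<in> {s..t}"
        have "\<bar>f' y * g y - g t * f' y + (f y * g' y - f s * g' y)\<bar>
            = \<bar>(g y - g t) * f' y + (f y - f s) * g' y\<bar>"
          by (simp add: algebra_simps)
        also have "\<dots> \<le> \<bar>g y - g t\<bar> * \<bar>f' y\<bar> + \<bar>f y - f s\<bar> * \<bar>g' y\<bar>"
          by (metis abs_mult abs_triangle_ineq)
        also have "\<dots> \<le> e * \<bar>f' y\<bar> + e * \<bar>g' y\<bar>"
          using osc[OF y] by (intro add_mono mult_right_mono) auto
        finally show "\<bar>f' y * g y - g t * f' y + (f y * g' y - f s * g' y)\<bar> \<le> e * (\<bar>f' y\<bar> + \<bar>g' y\<bar>)"
          by (simp add: algebra_simps)
      qed
      finally show "\<bar>I s t\<bar> \<le> e * M s t"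
        by (simp add: M_def)
    qed (use d in auto)
  qed
  moreover have "((\<lambda>e. e * M a b) \<longlongrightarrow> 0) (at_right 0)"
    by (auto intro!: tendsto_eq_intros)
  ultimately have "\<bar>I a b\<bar> \<le> 0"
    by (intro tendsto_lowerbound[of "\<lambda>e. e * M a b" 0 "at_right 0"])
       (auto simp: eventually_at_filter)
  then show ?thesis by (simp add: I_def)
qed

section \<open>Periodic Green functions\<close>

text \<open>The function \<open>green s\<close> is the sum of \<open>exp (2 \<pi> i k x) / (2 \<pi> i k) ^ s\<close> over \<open>k \<noteq> 0\<close>, with
  \<open>green_term s n\<close> collecting \<open>k = \<plusminus>(n + 1)\<close>; for \<open>s = 1\<close>, where convergence is only
  conditional, it is given in closed form.\<close>

definition green_term :: "nat \<Rightarrow> nat \<Rightarrow> real \<Rightarrow> real" where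
  "green_term s n x =
     2 * cos (2 * pi * real (Suc n) * x - real s * (pi / 2)) / (2 * pi * real (Suc n)) ^ s"

definition green :: "nat \<Rightarrow> real \<Rightarrow> real" where
  "green s x = (if s = 1 then 1 / 2 - frac x else (\<Sum>n. green_term s n x))"

lemma green_term_plus_1: "green_term s n (x + 1) = green_term s n x"
proof -
  have "2 * pi * real (Suc n) * (x + 1) - real s * (pi / 2)
      = (2 * pi * real (Suc n) * x - real s * (pi / 2)) + 2 * real (Suc n) * pi"
    by (simp add: algebra_simps)
  then have "cos (2 * pi * real (Suc n) * (x + 1) - real s * (pi / 2))
      = cos (2 * pi * real (Suc n) * x - real s * (pi / 2))"
    by (simp only: cos_add cos_2npi sin_2npi)
  then show ?thesis by (simp only: green_term_def)
qed

lemma green_plus_1: "green s (x + 1) = green s x"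
  by (simp add: green_def green_term_plus_1 frac_1_eq)

text \<open>Division by the \<open>s\<close>-th power of the imaginary unit is a phase shift by
  \<open>s\<close> quarter turns; differentiation multiplies by the frequency and takes one quarter
  turn back.\<close>

lemma DERIV_green_term: "(green_term (Suc s) n has_real_derivative green_term s n x) (at x)"
proof -
  define c where "c = 2 * pi * real (Suc n)"
  have c: "c \<noteq> 0" by (simp add: c_def del: of_nat_Suc)
  have "((\<lambda>x. 2 * cos (c * x - real (Suc s) * (pi / 2)) / c ^ Suc s) has_real_derivative
        2 * (- sin (c * x - real (Suc s) * (pi / 2)) * c) / c ^ Suc s) (at x)"
    by (auto intro!: derivative_eq_intros)
  also have "- sin (c * x - real (Suc s) * (pi / 2)) = cos (c * x - real s * (pi / 2))"
  proof -
    have "c * x - real (Suc s) * (pi / 2) = (c * x - real s * (pi / 2)) - pi / 2"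
      by (simp add: algebra_simps add_divide_distrib)
    then show ?thesis by (simp only: sin_diff) simp
  qed
  also have "2 * (cos (c * x - real s * (pi / 2)) * c) / c ^ Suc s = green_term s n x"
    using c by (simp add: green_term_def c_def del: of_nat_Suc)
  finally show ?thesis
    by (simp add: green_term_def[abs_def] c_def del: of_nat_Suc)
qed

lemma continuous_on_green_term: "continuous_on A (green_term s n)"
  unfolding green_term_def[abs_def] by (intro continuous_intros) (simp del: of_nat_Suc)

lemma green_term_1: "green_term 1 n x = sin (2 * pi * real (Suc n) * x) / (pi * real (Suc n))"
  unfolding green_term_def power_one_right of_nat_1 mult_1 by (simp add: cos_diff del: of_nat_Suc)

lemma abs_green_1_le: "\<bar>green 1 x\<bar> \<le> 1 / 2"
proof -
  have "\<bar>1 / 2 - frac x\<bar> \<le> 1 / 2" using frac_ge_0[of x] frac_lt_1[of x] by linarith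
  then show ?thesis by (simp add: green_def)
qed

lemma abs_green_term_le:
  assumes "s \<ge> 2"
  shows "\<bar>green_term s n x\<bar> \<le> 1 / real (Suc n) ^ 2"
proof -
  define c where "c = 2 * pi * real (Suc n)"
  have "4 * real (Suc n) \<le> c"
    unfolding c_def using pi_ge_two by (intro mult_right_mono) auto
  moreover have "1 \<le> 4 * real (Suc n)" by simp
  ultimately have c: "4 * real (Suc n) \<le> c" "1 \<le> c" by (blast intro: order_trans)+
  have "(4 * real (Suc n))\<^sup>2 \<le> c ^ 2"
    using c(1) by (intro power_mono) auto
  also have "\<dots> \<le> c ^ s" using c(2) assms by (intro power_increasing) auto
  finally have "2 * real (Suc n) ^ 2 \<le> c ^ s"
    by (simp add: power_mult_distrib del: of_nat_Suc) (smt (verit) zero_le_power2)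
  then have "2 / c ^ s \<le> 1 / real (Suc n) ^ 2"
    using c(2) by (simp add: field_simps del: of_nat_Suc)
  moreover have "\<bar>green_term s n x\<bar> \<le> 2 / c ^ s"
    unfolding green_term_def c_def[symmetric] using c(2) by (simp add: abs_mult divide_right_mono)
  ultimately show ?thesis by linarith
qed

lemma summable_inverse_Suc_square: "summable (\<lambda>n. 1 / real (Suc n) ^ 2)"
  using inverse_power_summable[of 2, where 'a = real]
  by (subst summable_Suc_iff[of "\<lambda>n. 1 / real n ^ 2"]) (simp add: field_simps)

lemma green_sums: "s \<ge> 2 \<Longrightarrow> (\<lambda>n. green_term s n x) sums green s x"
  using summable_comparison_test'[OF summable_inverse_Suc_square, of 0 "\<lambda>n. green_term s n x"]
    abs_green_term_le[of s _ x]
  by (simp add: green_def summable_sums)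

lemma green_uniform_limit:
  assumes "s \<ge> 2"
  shows "uniform_limit A (\<lambda>n x. \<Sum>i<n. green_term s i x) (green s) sequentially"
proof -
  have "green s = (\<lambda>x. \<Sum>i. green_term s i x)" using assms by (auto simp: green_def)
  then show ?thesis
    using abs_green_term_le[OF assms]
    by (auto intro!: Weierstrass_m_test[OF _ summable_inverse_Suc_square])
qed

lemma continuous_on_green: "s \<ge> 2 \<Longrightarrow> continuous_on A (green s)"
  by (rule uniform_limit_theorem[OF _ green_uniform_limit])
     (simp_all add: continuous_on_sum continuous_on_green_term)

text \<open>Termwise integration under a Weierstrass majorant of the differentiated series
  \<open>v\<close>. It serves the kernels of order at least 2, and order 1 after Abel
  damping.\<close>

lemma has_gen_deriv_series:
  assumes deriv: "\<And>n x. (u n has_real_derivative v n x) (at x)"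
    and cont: "\<And>n. continuous_on UNIV (v n)"
    and bound: "\<And>n x. \<bar>v n x\<bar> \<le> M n" and "summable M"
    and U: "\<And>x. (\<lambda>n. u n x) sums U x" and V: "\<And>x. (\<lambda>n. v n x) sums V x"
  shows "has_gen_deriv U V" "continuous_on UNIV V"
proof -
  have V': "V = (\<lambda>x. \<Sum>n. v n x)" using V by (auto simp: sums_iff)
  have unif: "uniform_limit A (\<lambda>n x. \<Sum>i<n. v i x) V sequentially" for A
    unfolding V' using bound by (intro Weierstrass_m_test[OF _ \<open>summable M\<close>]) auto
  show cV: "continuous_on UNIV V"
    by (rule uniform_limit_theorem[OF _ unif]) (simp_all add: continuous_on_sum cont)
  show "has_gen_deriv U V"
    unfolding has_gen_deriv_def
  proof (intro allI impI conjI)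
    fix a b :: real assume ab: "a \<le> b"
    have cV': "continuous_on {a..b} V" using cV by (rule continuous_on_subset) simp
    then show "V absolutely_integrable_on {a..b}"
      by (rule absolutely_integrable_continuous_real)
    have c: "continuous_on {a..b} (\<lambda>x. \<Sum>i<n. v i x)" for n
      by (intro continuous_on_sum continuous_on_subset[OF cont]) auto
    obtain I J where IJ: "\<And>n. ((\<lambda>x. \<Sum>i<n. v i x) has_integral I n) {a..b}"
        "(V has_integral J) {a..b}" "I \<longlonglongrightarrow> J"
      using uniform_limit_integral[OF unif c] by (metis sequentially_bot)
    have "I n = (\<Sum>i<n. u i b) - (\<Sum>i<n. u i a)" for n
    proof -
      have "((\<lambda>x. \<Sum>i<n. v i x) has_integral (\<Sum>i<n. u i b) - (\<Sum>i<n. u i a)) {a..b}"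
        using ab
      proof (rule fundamental_theorem_of_calculus)
        fix x
        have "((\<lambda>x. \<Sum>i<n. u i x) has_real_derivative (\<Sum>i<n. v i x)) (at x within {a..b})"
          by (intro DERIV_sum has_field_derivative_at_within[OF deriv])
        then show "((\<lambda>x. \<Sum>i<n. u i x) has_vector_derivative (\<Sum>i<n. v i x)) (at x within {a..b})"
          by (simp add: has_real_derivative_iff_has_vector_derivative)
      qed
      then show ?thesis using IJ(1) has_integral_unique by blast
    qed
    then have "I \<longlonglongrightarrow> U b - U a"
      using tendsto_diff[OF U[of b, unfolded sums_def] U[of a, unfolded sums_def]] by presburger
    then have "J = U b - U a" using IJ(3) LIMSEQ_unique by blast
    then show "integral {a..b} V = U b - U a" using IJ(2) by (simp add: integral_unique)
  qed
qed

lemma has_gen_deriv_green_ge_2: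
  assumes "s \<ge> 2" shows "has_gen_deriv (green (Suc s)) (green s)"
  using assms
  by (intro has_gen_deriv_series(1)[where u = "green_term (Suc s)" and v = "green_term s",
        OF DERIV_green_term continuous_on_green_term abs_green_term_le[OF assms]
        summable_inverse_Suc_square] green_sums) auto

text \<open>With \<open>a = pi * t\<close>, \<open>1 - cis (2 * a)\<close> equals
  \<open>2 * sin a * cis (a - pi / 2)\<close>, and this phase lies in the principal range. Divided
  by \<open>- pi\<close> it is the sawtooth \<open>1 / 2 - t\<close>.\<close>

lemma Ln_one_minus_cis:
  assumes "0 < t" "t < 1"
  shows "Ln (1 - cis (2 * pi * t)) = Complex (ln (2 * sin (pi * t))) (pi * t - pi / 2)"
proof -
  have s: "sin (pi * t) > 0" using assms by (intro sin_gt_zero) auto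
  let ?z = "Complex (ln (2 * sin (pi * t))) (pi * t - pi / 2)"
  have "exp ?z = 1 - cis (2 * pi * t)"
    using s cos_double_sin[of "pi * t"] sin_double[of "pi * t"]
    by (auto simp: complex_eq_iff Re_exp Im_exp sin_diff cos_diff power2_eq_square mult_ac)
  moreover have "- pi < Im ?z" "Im ?z \<le> pi"
    using mult_strict_left_mono[OF \<open>t < 1\<close> pi_gt_zero] mult_pos_pos[OF pi_gt_zero \<open>0 < t\<close>] pi_gt_zero
    unfolding complex.sel by linarith+
  ultimately show ?thesis using Ln_exp by metis
qed

text \<open>Abel summation of the Fourier series of the sawtooth, which does not converge uniformly.\<close>

lemma abel_sawtooth_sums:
  assumes "0 \<le> r" "r < 1"
  shows "(\<lambda>n. r ^ Suc n * green_term 1 n x) sums (- Im (Ln (1 - of_real r * cis (2 * pi * x))) / pi)"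
proof -
  let ?w = "of_real r * cis (2 * pi * x)"
  have w: "cmod (- ?w) < 1" using assms by (simp add: norm_mult)
  have "(\<lambda>n. - (?w ^ n) / of_nat n) sums Ln (1 - ?w)"
    using Ln_series'[OF w] by simp
  \<comment> \<open>The term for \<open>n = 0\<close> is a division by zero and therefore
    \<open>0\<close>, so the shift of the index leaves the sum unchanged.\<close>
  then have "(\<lambda>n. - (?w ^ Suc n) / of_nat (Suc n)) sums Ln (1 - ?w)"
    using sums_Suc_iff[of "\<lambda>n. - (?w ^ n) / of_nat n" "Ln (1 - ?w)"] by simp
  then have "(\<lambda>n. - Im (- (?w ^ Suc n) / of_nat (Suc n)) / pi) sums (- Im (Ln (1 - ?w)) / pi)"
    by (intro sums_divide sums_minus sums_Im)
  moreover have "- Im (- (?w ^ Suc n) / of_nat (Suc n)) / pi = r ^ Suc n * green_term 1 n x" for n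
  proof -
    have "?w ^ Suc n = of_real (r ^ Suc n) * cis (2 * pi * real (Suc n) * x)"
      by (simp only: power_mult_distrib Complex.DeMoivre of_real_power mult_ac)
    moreover have "Im (z / of_nat k) = Im z / real k" for z k
      by (metis Im_divide_of_real of_real_of_nat_eq)
    ultimately show ?thesis
      by (simp only: green_term_1) (simp del: of_nat_Suc power_Suc)
  qed
  ultimately show ?thesis by simp
qed

text \<open>Damping keeps the argument of \<open>Ln\<close> in the right half plane. The bound does
  not depend on \<open>r\<close>, which makes it the dominating function for the limit
  \<open>r \<rightarrow> 1\<close>.\<close>

lemma abs_abel_sawtooth_le:
  assumes "0 \<le> r" "r < 1"
  shows "\<bar>- Im (Ln (1 - of_real r * cis (2 * pi * x))) / pi\<bar> \<le> 1 / 2"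
proof -
  have "Re (of_real r * cis (2 * pi * x)) < 1"
    using assms complex_Re_le_cmod[of "of_real r * cis (2 * pi * x)"] by (simp add: norm_mult)
  then have "Re (1 - of_real r * cis (2 * pi * x)) > 0" by simp
  then have "\<bar>Im (Ln (1 - of_real r * cis (2 * pi * x)))\<bar> < pi / 2"
    using Re_Ln_pos_lt by (metis less_irrefl zero_complex.sel(1))
  then show ?thesis by (simp add: field_simps)
qed

lemma cis_two_pi_frac: "cis (2 * pi * frac x) = cis (2 * pi * x)"
proof -
  have "2 * pi * x = 2 * pi * frac x + 2 * pi * of_int \<lfloor>x\<rfloor>"
    by (simp add: frac_def algebra_simps)
  then show ?thesis by (metis cis_mult cis_multiple_2pi Ints_of_int mult.right_neutral)
qed

text \<open>Off the integers \<open>1 - cis (2 * pi * x)\<close> avoids the branch cut, so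
  \<open>Ln\<close> is continuous there. At integers every damped sum is \<open>0\<close> whereas
  \<open>green 1\<close> is \<open>1 / 2\<close>; this discrepancy is confined to a null
  set.\<close>

lemma abel_sawtooth_tendsto:
  assumes r: "\<And>j. 0 \<le> r j" "\<And>j. r j < 1" "r \<longlonglongrightarrow> 1"
  shows "(\<lambda>j. - Im (Ln (1 - of_real (r j) * cis (2 * pi * x))) / pi)
           \<longlonglongrightarrow> (if x \<in> \<int> then 0 else green 1 x)"
proof (cases "x \<in> \<int>")
  case True
  then have "cis (2 * pi * x) = 1" by (metis cis_multiple_2pi)
  moreover have "Im (Ln (of_real (1 - r j))) = 0" for j
    using r(2)[of j] by (subst Im_Ln_of_real) auto
  ultimately show ?thesis using True by simp
next
  case False
  define t where "t = frac x"
  have t: "0 < t" "t < 1" using False frac_lt_1 by (auto simp: t_def frac_gt_0_iff)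
  have c: "cis (2 * pi * x) = cis (2 * pi * t)" by (simp add: t_def cis_two_pi_frac)
  have "cos (2 * pi * t) < 1"
  proof -
    have "sin (pi * t) > 0" using t by (intro sin_gt_zero) auto
    then show ?thesis using cos_double_sin[of "pi * t"] by (simp add: mult_ac)
  qed
  then have "1 - cis (2 * pi * t) \<notin> \<real>\<^sub>\<le>\<^sub>0"
    by (auto simp: complex_nonpos_Reals_iff)
  then have "(\<lambda>j. - Im (Ln (1 - of_real (r j) * cis (2 * pi * t))) / pi) \<longlonglongrightarrow>
      - Im (Ln (1 - of_real 1 * cis (2 * pi * t))) / pi"
    by (intro tendsto_intros r(3)) auto
  then show ?thesis
    using False t by (simp add: c Ln_one_minus_cis green_def t_def diff_divide_distrib)
qed

text \<open>The Abel-damped series \<open>A j\<close> and \<open>B j\<close> of orders 2 and 1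
  satisfy the claim termwise. Letting the damping tend to 1, the left side converges by uniformity
  in the damping factor and the right side by dominated convergence.\<close>

lemma has_gen_deriv_green_1: "has_gen_deriv (green 2) (green 1)"
  unfolding has_gen_deriv_def
proof (intro allI impI conjI)
  fix a b :: real assume ab: "a \<le> b"
  define r where "r j = 1 - 1 / real (Suc j)" for j
  have r: "0 \<le> r j" "r j < 1" for j by (auto simp: r_def field_simps)
  have r1: "r \<longlonglongrightarrow> 1"
    unfolding r_def[abs_def] using tendsto_diff[OF tendsto_const LIMSEQ_inverse_real_of_nat, of 1]
    by (simp add: inverse_eq_divide)
  define B where "B j x = - Im (Ln (1 - of_real (r j) * cis (2 * pi * x))) / pi" for j x
  define A where "A j x = (\<Sum>n. r j ^ Suc n * green_term 2 n x)" for j x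
  have Asum: "(\<lambda>n. r j ^ Suc n * green_term 2 n x) sums A j x" for j x
    unfolding A_def
  proof (intro summable_sums summable_comparison_test'[OF summable_inverse_Suc_square, of 0])
    fix n
    have "r j ^ Suc n * \<bar>green_term 2 n x\<bar> \<le> 1 * (1 / real (Suc n) ^ 2)"
      using r[of j] abs_green_term_le[of 2 n x] by (intro mult_mono power_le_one) auto
    then show "norm (r j ^ Suc n * green_term 2 n x) \<le> 1 / real (Suc n) ^ 2"
      using r(1)[of j] by (simp add: abs_mult)
  qed
  have AB: "has_gen_deriv (A j) (B j)" for j
  proof (rule has_gen_deriv_series(1)[where u = "\<lambda>n x. r j ^ Suc n * green_term 2 n x"
        and v = "\<lambda>n x. r j ^ Suc n * green_term 1 n x" and M = "\<lambda>n. r j ^ Suc n"])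
    show "((\<lambda>x. r j ^ Suc n * green_term 2 n x) has_real_derivative r j ^ Suc n * green_term 1 n x) (at x)"
      for n x
      using DERIV_cmult[OF DERIV_green_term[of 1 n x], of "r j ^ Suc n"] by (simp add: numeral_2_eq_2)
    show "\<bar>r j ^ Suc n * green_term 1 n x\<bar> \<le> r j ^ Suc n" for n x
    proof -
      have "\<bar>green_term 1 n x\<bar> = \<bar>sin (2 * pi * real (Suc n) * x)\<bar> / (pi * real (Suc n))"
        unfolding green_term_1 abs_divide by (simp add: abs_mult del: of_nat_Suc)
      also have "\<dots> \<le> 1 / 1"
      proof (rule frac_le)
        show "1 \<le> pi * real (Suc n)"
          using mult_mono[of 1 pi 1 "real (Suc n)"] pi_ge_two by auto
      qed auto
      finally have "\<bar>green_term 1 n x\<bar> \<le> 1" by simp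
      then show ?thesis
        using r(1)[of j] mult_left_mono[of "\<bar>green_term 1 n x\<bar>" 1 "r j ^ Suc n"] by (simp add: abs_mult)
    qed
    show "summable (\<lambda>n. r j ^ Suc n)"
      using r[of j] by (subst summable_Suc_iff) (auto intro: summable_geometric)
    show "(\<lambda>n. r j ^ Suc n * green_term 1 n x) sums B j x" for x
      unfolding B_def by (rule abel_sawtooth_sums) (rule r)+
  qed (intro continuous_intros continuous_on_green_term Asum)+
  have Alim: "(\<lambda>j. A j x) \<longlonglongrightarrow> green 2 x" for x
  proof -
    let ?F = "\<lambda>\<rho>. \<Sum>n. \<rho> ^ Suc n * green_term 2 n x"
    \<comment> \<open>Here \<open>x\<close> is fixed and the damping factor \<open>\<rho>\<close> is
      the variable: uniform convergence on the closed interval gives continuity up to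
      \<open>\<rho> = 1\<close>, which is Abel's limit.\<close>
    have "uniform_limit {0..1} (\<lambda>N \<rho>. \<Sum>n<N. \<rho> ^ Suc n * green_term 2 n x) ?F sequentially"
    proof (rule Weierstrass_m_test[OF _ summable_inverse_Suc_square])
      fix n and \<rho> :: real assume "\<rho> \<in> {0..1}"
      then have "\<rho> ^ Suc n * \<bar>green_term 2 n x\<bar> \<le> 1 * (1 / real (Suc n) ^ 2)"
        using abs_green_term_le[of 2 n x] by (intro mult_mono power_le_one) auto
      then show "norm (\<rho> ^ Suc n * green_term 2 n x) \<le> 1 / real (Suc n) ^ 2"
        using \<open>\<rho> \<in> _\<close> by (simp add: abs_mult)
    qed
    then have "continuous_on {0..1} ?F"
      by (rule uniform_limit_theorem[rotated]) (auto intro!: always_eventually continuous_intros simp del: power_Suc)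
    then have "(\<lambda>j. ?F (r j)) \<longlonglongrightarrow> ?F 1"
      using r by (intro continuous_on_tendsto_compose[OF _ r1]) (auto simp: less_imp_le)
    then show ?thesis by (simp add: A_def green_def)
  qed
  have lim: "((\<lambda>x. if x \<in> \<int> then 0 else green 1 x) has_integral (green 2 b - green 2 a)) {a..b}"
  proof (rule has_integral_dominated_convergence[where f = B and y = "\<lambda>j. A j b - A j a" and h = "\<lambda>_. 1 / 2"])
    show "(B j has_integral (A j b - A j a)) {a..b}" for j
      using has_gen_deriv_abs_int[OF AB[of j], of a b] has_gen_deriv_integral[OF AB[of j] ab]
      by (metis absolutely_integrable_on_def has_integral_integral)
    show "\<forall>x\<in>{a..b}. norm (B j x) \<le> 1 / 2" for j
      unfolding B_def real_norm_def using abs_abel_sawtooth_le[OF r] by blast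
    show "\<forall>x\<in>{a..b}. (\<lambda>j. B j x) \<longlonglongrightarrow> (if x \<in> \<int> then 0 else green 1 x)"
      unfolding B_def using abel_sawtooth_tendsto[OF r r1] by blast
    show "(\<lambda>j. A j b - A j a) \<longlonglongrightarrow> green 2 b - green 2 a"
      by (intro tendsto_diff Alim)
  qed (rule integrable_const_ivl)
  have neg: "negligible (\<int> :: real set)"
    by (simp add: negligible_iff_null_sets Ints_def countable_imp_null_set_lborel null_sets_completionI)
  have int: "(green 1 has_integral (green 2 b - green 2 a)) {a..b}"
    by (rule has_integral_spike[OF neg _ lim]) auto
  then show "integral {a..b} (green 1) = green 2 b - green 2 a"
    by (rule integral_unique)
  show "green 1 absolutely_integrable_on {a..b}"
  proof (rule absolutely_integrable_integrable_bound)
    show "norm (green 1 x) \<le> 1 / 2" for x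
      using abs_green_1_le by simp
    show "green 1 integrable_on {a..b}" using int by blast
  qed (rule integrable_const_ivl)
qed

lemma has_gen_deriv_green:
  assumes "s \<ge> 1" shows "has_gen_deriv (green (Suc s)) (green s)"
proof (cases "s = 1")
  case True then show ?thesis using has_gen_deriv_green_1 by (simp add: numeral_2_eq_2)
next
  case False then show ?thesis using assms by (intro has_gen_deriv_green_ge_2) auto
qed

lemma green_measurable: "s \<ge> 1 \<Longrightarrow> green s \<in> borel_measurable borel"
  using continuous_on_green[of s UNIV]
  by (cases "s = 1") (auto simp: green_def[abs_def] frac_def intro!: borel_measurable_continuous_onI)

lemma green_bounded:
  assumes "s \<ge> 1" obtains B where "\<And>x. \<bar>green s x\<bar> \<le> B"
proof (cases "s = 1")
  case True
  then show ?thesis using that abs_green_1_le by blast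
next
  case False
  have "\<bar>green s x\<bar> \<le> (\<Sum>n. 1 / real (Suc n) ^ 2)" for x
    using False assms abs_green_term_le[of s _ x] 
      norm_suminf_le[OF _ summable_inverse_Suc_square, of "\<lambda>n. green_term s n x"]
    by (simp add: green_def del: of_nat_Suc)
  then show ?thesis using that by blast
qed

section \<open>The reproducing formula\<close>

lemma has_gen_deriv_continuous_unique:
  assumes "has_gen_deriv f g1" "has_gen_deriv f g2" "continuous_on UNIV g1" "continuous_on UNIV g2"
  shows "g1 = g2"
  using assms DERIV_unique has_gen_deriv_DERIV by blast

lemma has_gen_deriv_n_Suc_continuous: "has_gen_deriv_n (Suc n) f g \<Longrightarrow> continuous_on UNIV f"
  using has_gen_deriv_continuous by auto

text \<open>Derivatives below the top order are continuous, hence classical and unique. Freedom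
  remains only in the last step, where the integrals are increments of the derivative just
  below.\<close>

lemma has_gen_deriv_n_integral_unique:
  assumes "has_gen_deriv_n (Suc n) f g1" "has_gen_deriv_n (Suc n) f g2" "a \<le> b"
  shows "integral {a..b} g1 = integral {a..b} g2"
  using assms
proof (induction n arbitrary: f)
  case 0
  then show ?case using has_gen_deriv_integral[of f _ a b] by auto
next
  case (Suc n)
  obtain f1 f2 where f: "has_gen_deriv f f1" "has_gen_deriv_n (Suc n) f1 g1"
      "has_gen_deriv f f2" "has_gen_deriv_n (Suc n) f2 g2"
    using Suc.prems has_gen_deriv_n.simps(2) by metis
  then have "f1 = f2"
    using has_gen_deriv_continuous_unique has_gen_deriv_n_Suc_continuous by blast
  then show ?case using f Suc.IH Suc.prems(3) by blast
qed

lemma has_gen_deriv_n_abs_int: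
  "has_gen_deriv_n (Suc n) f g \<Longrightarrow> g absolutely_integrable_on {a..b}"
proof (induction n arbitrary: f)
  case 0 then show ?case using has_gen_deriv_abs_int by auto
next
  case (Suc n) then show ?case by (metis has_gen_deriv_n.simps(2))
qed

lemma has_gen_deriv_n_gen_deriv: "has_gen_deriv_n m f g \<Longrightarrow> has_gen_deriv_n m f (gen_deriv m f)"
  using someI[of "has_gen_deriv_n m f" g] by (simp add: gen_deriv_def)

lemma gen_deriv_AE:
  assumes g: "has_gen_deriv_n m f g" and "m \<ge> 1"
  obtains S where "negligible S" "\<And>x. x \<in> {a..b} - S \<Longrightarrow> gen_deriv m f x = g x"
proof -
  obtain n where m: "m = Suc n" using \<open>m \<ge> 1\<close> by (cases m) auto
  note d = has_gen_deriv_n_gen_deriv[OF g, unfolded m] g[unfolded m]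
  show ?thesis
  proof (rule AE_eq_of_subinterval_integrals[OF has_gen_deriv_n_abs_int[OF d(1)] has_gen_deriv_n_abs_int[OF d(2)]])
    show "integral {c..e} (gen_deriv (Suc n) f) = integral {c..e} g" if "c \<le> e" for c e
      using has_gen_deriv_n_integral_unique[OF d that] .
  qed (use that m in blast)
qed

text \<open>Makes the boundary terms cancel in repeated integration by parts. Continuity of
  \<open>f'\<close> makes the derivative classical; a top derivative is determined only almost
  everywhere and need not be pointwise periodic.\<close>

lemma has_gen_deriv_periodic:
  assumes f: "has_gen_deriv f f'" and "continuous_on UNIV f'" and per: "\<And>x. f (x + 1) = f x"
  shows "f' (x + 1) = f' x"
proof -
  have "(f has_real_derivative f' (x + 1)) (at (x + 1))" "(f has_real_derivative f' x) (at x)"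
    using has_gen_deriv_DERIV[OF assms(1,2)] by auto
  moreover have "((\<lambda>x. f (x + 1)) has_real_derivative f' (x + 1)) (at x)"
    using calculation(1) by (simp add: DERIV_shift)
  ultimately show ?thesis using DERIV_unique per by (metis (no_types, lifting) ext)
qed

lemma has_gen_deriv_n_add:
  "has_gen_deriv_n n f f' \<Longrightarrow> has_gen_deriv_n n g g' \<Longrightarrow>
     has_gen_deriv_n n (\<lambda>x. f x + g x) (\<lambda>x. f' x + g' x)"
proof (induction n arbitrary: f g)
  case (Suc n)
  then obtain u v where "has_gen_deriv f u" "has_gen_deriv_n n u f'" "has_gen_deriv g v" "has_gen_deriv_n n v g'"
    by auto
  then show ?case using Suc.IH has_gen_deriv_add by (metis has_gen_deriv_n.simps(2))
qed simp

lemma has_gen_deriv_n_cmult: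
  "has_gen_deriv_n n f f' \<Longrightarrow> has_gen_deriv_n n (\<lambda>x. c * f x) (\<lambda>x. c * f' x)"
proof (induction n arbitrary: f)
  case (Suc n)
  then show ?case using has_gen_deriv_cmult by (metis has_gen_deriv_n.simps(2))
qed simp

lemma has_gen_deriv_n_zero: "has_gen_deriv_n n (\<lambda>x. 0) (\<lambda>x. 0)"
  by (induction n) (auto simp: has_gen_deriv_def)

lemma has_gen_deriv_n_sum:
  assumes "finite A" "\<And>i. i \<in> A \<Longrightarrow> has_gen_deriv_n n (f i) (f' i)"
  shows "has_gen_deriv_n n (\<lambda>x. \<Sum>i\<in>A. f i x) (\<lambda>x. \<Sum>i\<in>A. f' i x)"
  using assms by (induction A rule: finite_induct) (auto intro: has_gen_deriv_n_zero has_gen_deriv_n_add)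

lemma has_gen_deriv_n_green:
  assumes "s \<ge> 1"
  shows "has_gen_deriv_n n (\<lambda>t. c * green (s + n) (x - t)) (\<lambda>t. (-1) ^ n * c * green s (x - t))"
proof (induction n arbitrary: c)
  case (Suc n)
  have "has_gen_deriv (\<lambda>t. c * green (s + Suc n) (x - t)) (\<lambda>t. c * - green (s + n) (x - t))"
    using assms has_gen_deriv_green[of "s + n"] by (intro has_gen_deriv_cmult has_gen_deriv_reflect) simp
  then show ?case
    using Suc[of "- c"] by auto
qed simp

lemma bounded_borel_abs_int:
  fixes G :: "real \<Rightarrow> real"
  assumes "G \<in> borel_measurable borel" "\<And>t. \<bar>G t\<bar> \<le> B" "g absolutely_integrable_on {a..b}"
  shows "(\<lambda>t. g t * G t) absolutely_integrable_on {a..b}"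
proof -
  have "G \<in> borel_measurable (lebesgue_on {a..b})"
    using assms(1) by (intro measurable_restrict_space1 measurable_completion) simp
  then have "(\<lambda>t. G t * g t) absolutely_integrable_on {a..b}"
    by (rule absolutely_integrable_bounded_measurable_product_real) (use assms in \<open>auto simp: bounded_iff\<close>)
  then show ?thesis by (simp add: mult.commute)
qed

lemma green_mult_abs_int:
  assumes "s \<ge> 1" "g absolutely_integrable_on {a..b}"
  shows "(\<lambda>t. g t * green s (x - t)) absolutely_integrable_on {a..b}"
proof -
  obtain B where B: "\<And>x. \<bar>green s x\<bar> \<le> B" using green_bounded[OF assms(1)] by blast
  have "(\<lambda>t. green s (x - t)) \<in> borel_measurable borel"
    by (rule measurable_compose[OF _ green_measurable[OF assms(1)]]) simp
  then show ?thesis using B assms(2) by (rule bounded_borel_abs_int)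
qed

text \<open>Integration by parts over one period: the boundary terms cancel by periodicity, and the
  sign of the partial integration cancels the sign from differentiating in
  \<open>x - t\<close>.\<close>

lemma integral_mult_green:
  assumes f: "has_gen_deriv f f'" and per: "\<And>x. f (x + 1) = f x" and "s \<ge> 1"
  shows "integral {0..1} (\<lambda>t. f t * green s (x - t)) = integral {0..1} (\<lambda>t. f' t * green (Suc s) (x - t))"
proof -
  have g: "has_gen_deriv (\<lambda>t. green (Suc s) (x - t)) (\<lambda>t. - green s (x - t))"
    by (rule has_gen_deriv_reflect[OF has_gen_deriv_green[OF \<open>s \<ge> 1\<close>]])
  have "f 1 = f 0" using per[of 0] by simp
  moreover have "green (Suc s) (x - 1) = green (Suc s) x"
    using green_plus_1[of "Suc s" "x - 1"] by simp
  ultimately show ?thesis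
    using has_gen_deriv_by_parts[OF f g, of 0 1] by simp
qed

lemma integral_mult_green_n:
  assumes "has_gen_deriv_n n f g" "\<And>x. f (x + 1) = f x" "s \<ge> 1"
  shows "integral {0..1} (\<lambda>t. f t * green s (x - t)) = integral {0..1} (\<lambda>t. g t * green (s + n) (x - t))"
  using assms
proof (induction n arbitrary: f s)
  case (Suc n)
  obtain f' where f': "has_gen_deriv f f'" "has_gen_deriv_n n f' g"
    using Suc.prems by auto
  have step: "integral {0..1} (\<lambda>t. f t * green s (x - t)) = integral {0..1} (\<lambda>t. f' t * green (Suc s) (x - t))"
    by (rule integral_mult_green[OF f'(1) Suc.prems(2,3)])
  show ?case
  \<comment> \<open>The induction hypothesis asks for \<open>f'\<close> to be periodic, which is
    available only when \<open>f'\<close> is not yet the top derivative; for \<open>n = 0\<close> a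
    single step finishes.\<close>
  proof (cases n)
    case 0
    then show ?thesis using f' step by simp
  next
    case (Suc k)
    then have "f' (x + 1) = f' x" for x
      using has_gen_deriv_periodic[OF f'(1) _ Suc.prems(2)] f'(2) has_gen_deriv_n_Suc_continuous by blast
    then show ?thesis
      using Suc.IH[OF f'(2), of "Suc s"] step by simp
  qed
qed simp

text \<open>On either side of \<open>t = x\<close> the kernel is affine in \<open>t\<close> with
  slope 1. In the integration by parts its unit jump at \<open>x\<close> produces
  \<open>f x\<close>, the slope produces minus the mean, and the boundary terms at 0 and 1
  cancel.\<close>

lemma integral_gen_deriv_mult_green_1:
  assumes f: "has_gen_deriv f f'" and per: "\<And>x. f (x + 1) = f x" and x: "x \<in> {0..1}"
  shows "integral {0..1} (\<lambda>t. f' t * green 1 (x - t)) = f x - integral {0..1} f"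
proof -
  have lin: "has_gen_deriv (\<lambda>t. c + t) (\<lambda>_. 1)" for c :: real
    by (rule DERIV_imp_has_gen_deriv) (auto intro!: derivative_eq_intros)
  \<comment> \<open>The endpoints are dropped because for \<open>x = 1\<close>, \<open>t = 0\<close>
    the argument is \<open>1\<close> and \<open>frac\<close> has already jumped back to
    \<open>0\<close>.\<close>
  have neg: "negligible {0, 1 :: real}" by simp
  have "integral {0..x} (\<lambda>t. f' t * green 1 (x - t)) = integral {0..x} (\<lambda>t. f' t * ((1 / 2 - x) + t))"
  proof (rule integral_spike[OF neg])
    fix t assume "t \<in> {0..x} - {0, 1}"
    then have "frac (x - t) = x - t" using x by (subst frac_eq) auto
    then show "f' t * ((1 / 2 - x) + t) = f' t * green 1 (x - t)" by (simp add: green_def)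
  qed
  moreover have "integral {x..1} (\<lambda>t. f' t * green 1 (x - t)) = integral {x..1} (\<lambda>t. f' t * ((- 1 / 2 - x) + t))"
  proof (rule integral_spike)
    show "negligible {x, 0, 1}" by simp
    fix t assume "t \<in> {x..1} - {x, 0, 1}"
    then have "frac (x - t + 1) = x - t + 1" using x by (subst frac_eq) auto
    then have "frac (x - t) = x - t + 1" by (simp only: frac_1_eq)
    then show "f' t * ((- 1 / 2 - x) + t) = f' t * green 1 (x - t)" by (simp add: green_def)
  qed
  moreover have "(\<lambda>t. f' t * green 1 (x - t)) integrable_on {0..1}"
    using green_mult_abs_int[of 1, OF _ has_gen_deriv_abs_int[OF f]] by (simp add: absolutely_integrable_on_def)
  then have "integral {0..1} (\<lambda>t. f' t * green 1 (x - t)) =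
      integral {0..x} (\<lambda>t. f' t * green 1 (x - t)) + integral {x..1} (\<lambda>t. f' t * green 1 (x - t))"
    using x by (simp add: Henstock_Kurzweil_Integration.integral_combine)
  moreover have "f integrable_on {0..1}"
    by (rule integrable_continuous_real[OF has_gen_deriv_continuous_on[OF f]])
  then have "integral {0..1} f = integral {0..x} f + integral {x..1} f"
    using x by (simp add: Henstock_Kurzweil_Integration.integral_combine)
  moreover have "integral {0..x} (\<lambda>t. f' t * ((1 / 2 - x) + t)) + integral {0..x} f
      = f x * (1 / 2) - f 0 * (1 / 2 - x)"
    using has_gen_deriv_by_parts[OF f lin[of "1 / 2 - x"], of 0 x] x by simp
  moreover have "integral {x..1} (\<lambda>t. f' t * ((- 1 / 2 - x) + t)) + integral {x..1} f
      = f 1 * (1 / 2 - x) + f x * (1 / 2)"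
    using has_gen_deriv_by_parts[OF f lin[of "- 1 / 2 - x"], of x 1] x by simp
  moreover have "f 1 = f 0" using per[of 0] by simp
  ultimately show ?thesis by (simp add: algebra_simps)
qed

text \<open>Partial integration lowers the order of the kernel to 1, where the formula is explicit.
  The mean is lost because the kernel has no constant Fourier mode.\<close>

lemma green_reproducing:
  assumes g: "has_gen_deriv_n m f g" and per: "\<And>x. f (x + 1) = f x" and "m \<ge> 1" and x: "x \<in> {0..1}"
  shows "integral {0..1} (\<lambda>t. g t * green m (x - t)) = f x - integral {0..1} f"
proof -
  obtain n where m: "m = Suc n" using \<open>m \<ge> 1\<close> by (cases m) auto
  obtain f' where f': "has_gen_deriv f f'" "has_gen_deriv_n n f' g"
    using g m by auto
  have "integral {0..1} (\<lambda>t. f' t * green 1 (x - t)) = integral {0..1} (\<lambda>t. g t * green m (x - t))"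
  proof (cases n)
    case 0 then show ?thesis using f' m by simp
  next
    case (Suc k)
    then have "f' (x + 1) = f' x" for x
      using has_gen_deriv_periodic[OF f'(1) _ per] f'(2) has_gen_deriv_n_Suc_continuous by blast
    then show ?thesis using integral_mult_green_n[OF f'(2), of 1] m by simp
  qed
  then show ?thesis using integral_gen_deriv_mult_green_1[OF f'(1) per x] by simp
qed

section \<open>Representers and dual norms\<close>

lemma Cauchy_Schwarz_integral:
  fixes u v :: "real \<Rightarrow> real"
  assumes "(\<lambda>t. (u t)\<^sup>2) integrable_on S" "(\<lambda>t. (v t)\<^sup>2) integrable_on S" "(\<lambda>t. u t * v t) integrable_on S"
  shows "(integral S (\<lambda>t. u t * v t))\<^sup>2 \<le> integral S (\<lambda>t. (u t)\<^sup>2) * integral S (\<lambda>t. (v t)\<^sup>2)"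
proof -
  define a b c where "a = integral S (\<lambda>t. (u t)\<^sup>2)" and "b = integral S (\<lambda>t. u t * v t)"
    and "c = integral S (\<lambda>t. (v t)\<^sup>2)"
  have q: "0 \<le> x\<^sup>2 * a - 2 * x * b + c" for x
  proof -
    have "((\<lambda>t. x\<^sup>2 * (u t)\<^sup>2 - 2 * x * (u t * v t) + (v t)\<^sup>2) has_integral (x\<^sup>2 * a - 2 * x * b + c)) S"
      unfolding a_def b_def c_def
      by (intro has_integral_add has_integral_diff has_integral_mult_right integrable_integral assms)
    moreover have "x\<^sup>2 * (u t)\<^sup>2 - 2 * x * (u t * v t) + (v t)\<^sup>2 = (x * u t - v t)\<^sup>2" for t
      by (simp add: power2_diff power_mult_distrib mult_ac)
    ultimately show ?thesis by (metis (no_types, lifting) has_integral_nonneg zero_le_power2)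
  qed
  have "a \<ge> 0" unfolding a_def by (intro integral_nonneg assms) auto
  have "b\<^sup>2 \<le> a * c"
  proof (cases "a = 0")
    case True
    have "b = 0"
    proof (rule ccontr)
      assume "b \<noteq> 0"
      \<comment> \<open>For \<open>a = 0\<close> the quadratic is affine in \<open>x\<close>, and at
        this point its value is \<open>-1\<close>.\<close>
      then show False using q[of "(c + 1) / (2 * b)"] True by simp
    qed
    then show ?thesis using True by simp
  next
    case False
    then have "a > 0" using \<open>a \<ge> 0\<close> by simp
    have "(b / a)\<^sup>2 * a - 2 * (b / a) * b + c = c - b\<^sup>2 / a"
      using \<open>a > 0\<close> by (simp add: field_simps power2_eq_square)
    then have "b\<^sup>2 / a \<le> c" using q[of "b / a"] by simp
    then show ?thesis using \<open>a > 0\<close> by (simp add: field_simps)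
  qed
  then show ?thesis by (simp add: a_def b_def c_def)
qed

lemma gen_deriv_square:
  assumes g: "has_gen_deriv_n m f g" and "m \<ge> 1"
  shows "(\<lambda>t. (gen_deriv m f t)\<^sup>2) absolutely_integrable_on {0..1} \<longleftrightarrow>
           (\<lambda>t. (g t)\<^sup>2) absolutely_integrable_on {0..1}"
    and "integral {0..1} (\<lambda>t. (gen_deriv m f t)\<^sup>2) = integral {0..1} (\<lambda>t. (g t)\<^sup>2)"
    and "integral {0..1} (\<lambda>t. gen_deriv m f t * v t) = integral {0..1} (\<lambda>t. g t * v t)"
proof -
  obtain S where S: "negligible S" "\<And>x. x \<in> {0..1} - S \<Longrightarrow> gen_deriv m f x = g x"
    using gen_deriv_AE[OF assms] by blast
  show "(\<lambda>t. (gen_deriv m f t)\<^sup>2) absolutely_integrable_on {0..1} \<longleftrightarrow>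
           (\<lambda>t. (g t)\<^sup>2) absolutely_integrable_on {0..1}"
    by (rule absolutely_integrable_spike_eq[OF S(1)]) (simp add: S(2))
  show "integral {0..1} (\<lambda>t. (gen_deriv m f t)\<^sup>2) = integral {0..1} (\<lambda>t. (g t)\<^sup>2)"
    by (rule integral_spike[OF S(1)]) (simp add: S(2))
  show "integral {0..1} (\<lambda>t. gen_deriv m f t * v t) = integral {0..1} (\<lambda>t. g t * v t)"
    by (rule integral_spike[OF S(1)]) (simp add: S(2))
qed

lemma periodic_L2I:
  assumes "has_gen_deriv_n m f g" "m \<ge> 1" "\<And>x. f (x + 1) = f x"
    "(\<lambda>t. (g t)\<^sup>2) absolutely_integrable_on {0..1}"
  shows "f \<in> periodic_L2 m"
  using assms gen_deriv_square(1)[OF assms(1,2)] by (auto simp: periodic_L2_def)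

lemma bounded_borel_square_abs_int:
  fixes G :: "real \<Rightarrow> real"
  assumes "G \<in> borel_measurable borel" "\<And>t. \<bar>G t\<bar> \<le> B"
  shows "(\<lambda>t. (G t)\<^sup>2) absolutely_integrable_on {a..b}"
proof -
  have "(\<lambda>t. 1 * G t) absolutely_integrable_on {a..b}"
    by (rule bounded_borel_abs_int[OF assms]) (rule absolutely_integrable_continuous_real, rule continuous_on_const)
  then have "(\<lambda>t. G t * G t) absolutely_integrable_on {a..b}"
    using bounded_borel_abs_int[OF assms] by simp
  then show ?thesis by (simp add: power2_eq_square)
qed

lemma abs_repr_le:
  assumes "m \<ge> 1" and G: "G \<in> borel_measurable borel" "\<And>t. \<bar>G t\<bar> \<le> B" and \<phi>: "\<phi> \<in> periodic_L2 m"
  shows "\<bar>integral {0..1} (\<lambda>t. gen_deriv m \<phi> t * G t)\<bar>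
    \<le> periodic_norm m \<phi> * sqrt (integral {0..1} (\<lambda>t. (G t)\<^sup>2))"
proof -
  obtain n where m: "m = Suc n" using \<open>m \<ge> 1\<close> by (cases m) auto
  have "has_gen_deriv_n m \<phi> (gen_deriv m \<phi>)"
    and sq: "(\<lambda>t. (gen_deriv m \<phi> t)\<^sup>2) absolutely_integrable_on {0..1}"
    using \<phi> has_gen_deriv_n_gen_deriv by (auto simp: periodic_L2_def)
  then have "gen_deriv m \<phi> absolutely_integrable_on {0..1}"
    using has_gen_deriv_n_abs_int unfolding m by blast
  then have "(\<lambda>t. gen_deriv m \<phi> t * G t) integrable_on {0..1}"
    using bounded_borel_abs_int[OF G] absolutely_integrable_on_def by blast
  moreover have "(\<lambda>t. (G t)\<^sup>2) integrable_on {0..1}" "(\<lambda>t. (gen_deriv m \<phi> t)\<^sup>2) integrable_on {0..1}"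
    using bounded_borel_square_abs_int[OF G] sq absolutely_integrable_on_def by blast+
  ultimately have "(integral {0..1} (\<lambda>t. gen_deriv m \<phi> t * G t))\<^sup>2 \<le>
     integral {0..1} (\<lambda>t. (gen_deriv m \<phi> t)\<^sup>2) * integral {0..1} (\<lambda>t. (G t)\<^sup>2)"
    by (intro Cauchy_Schwarz_integral)
  then have "sqrt ((integral {0..1} (\<lambda>t. gen_deriv m \<phi> t * G t))\<^sup>2) \<le>
     sqrt (integral {0..1} (\<lambda>t. (gen_deriv m \<phi> t)\<^sup>2) * integral {0..1} (\<lambda>t. (G t)\<^sup>2))"
    by (rule real_sqrt_le_mono)
  then show ?thesis by (simp add: periodic_norm_def real_sqrt_mult)
qed

lemma dual_norm_le:
  assumes "m \<ge> 1" "G \<in> borel_measurable borel" "\<And>t. \<bar>G t\<bar> \<le> B"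
    and repr: "\<And>\<phi>. \<phi> \<in> periodic_L2 m \<Longrightarrow> l \<phi> = integral {0..1} (\<lambda>t. gen_deriv m \<phi> t * G t)"
  shows "dual_norm m l \<le> ereal (sqrt (integral {0..1} (\<lambda>t. (G t)\<^sup>2)))"
  unfolding dual_norm_def
proof (rule SUP_least)
  fix \<phi> assume "\<phi> \<in> {\<phi> \<in> periodic_L2 m. periodic_norm m \<phi> = 1}"
  then show "ereal \<bar>l \<phi>\<bar> \<le> ereal (sqrt (integral {0..1} (\<lambda>t. (G t)\<^sup>2)))"
    using abs_repr_le[OF assms(1-3), of \<phi>] repr by simp
qed

text \<open>If the representer is itself the \<open>m\<close>-th derivative of an element
  \<open>\<psi>\<close> of the space, equality in Cauchy-Schwarz is attained at
  \<open>\<psi>\<close> scaled to norm one.\<close>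

lemma dual_norm_ge:
  assumes "m \<ge> 1" "\<psi> \<in> periodic_L2 m" and G: "has_gen_deriv_n m \<psi> G" 
    and pos: "integral {0..1} (\<lambda>t. (G t)\<^sup>2) > 0"
    and repr: "\<And>\<phi>. \<phi> \<in> periodic_L2 m \<Longrightarrow> l \<phi> = integral {0..1} (\<lambda>t. gen_deriv m \<phi> t * G t)"
  shows "dual_norm m l \<ge> ereal (sqrt (integral {0..1} (\<lambda>t. (G t)\<^sup>2)))"
proof -
  define S where "S = integral {0..1} (\<lambda>t. (G t)\<^sup>2)"
  define \<phi> where "\<phi> = (\<lambda>t. (1 / sqrt S) * \<psi> t)"
  have d: "has_gen_deriv_n m \<phi> (\<lambda>t. (1 / sqrt S) * G t)"
    unfolding \<phi>_def by (rule has_gen_deriv_n_cmult[OF G])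
  have "S > 0" using pos by (simp add: S_def)
  have \<psi>: "\<psi> (x + 1) = \<psi> x" "(\<lambda>t. (G t)\<^sup>2) absolutely_integrable_on {0..1}" for x
    using assms(2) gen_deriv_square(1)[OF G \<open>m \<ge> 1\<close>] by (auto simp: periodic_L2_def)
  have sq: "((1 / sqrt S) * G t)\<^sup>2 = (1 / S) * (G t)\<^sup>2" for t
    using \<open>S > 0\<close> by (simp add: power_mult_distrib power_divide)
  have \<phi>L: "\<phi> \<in> periodic_L2 m"
    using \<psi> by (intro periodic_L2I[OF d \<open>m \<ge> 1\<close>]) (simp_all only: \<phi>_def sq set_integrable_mult_right)
  moreover have "periodic_norm m \<phi> = 1"
    using \<open>S > 0\<close> unfolding periodic_norm_def gen_deriv_square(2)[OF d \<open>m \<ge> 1\<close>] sq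
    by (simp flip: S_def)
  moreover have "l \<phi> = sqrt S"
  proof -
    have "l \<phi> = integral {0..1} (\<lambda>t. (1 / sqrt S) * G t * G t)"
      unfolding repr[OF \<phi>L] by (rule gen_deriv_square(3)[OF d \<open>m \<ge> 1\<close>])
    also have "\<dots> = (1 / sqrt S) * S"
      unfolding S_def power2_eq_square mult.assoc by (rule integral_mult_right)
    finally show ?thesis using \<open>S > 0\<close> by (simp add: real_div_sqrt)
  qed
  ultimately have "ereal (sqrt S) \<le> dual_norm m l"
    unfolding dual_norm_def using \<open>S > 0\<close> by (intro SUP_upper2[of \<phi>]) auto
  then show ?thesis by (simp add: S_def)
qed

definition green_comb :: "nat \<Rightarrow> 'i set \<Rightarrow> ('i \<Rightarrow> real) \<Rightarrow> ('i \<Rightarrow> real) \<Rightarrow> real \<Rightarrow> real" where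
  "green_comb s A p w t = (\<Sum>i\<in>A. w i * green s (p i - t))"

lemma green_comb_measurable: "s \<ge> 1 \<Longrightarrow> green_comb s A p w \<in> borel_measurable borel"
  unfolding green_comb_def[abs_def]
  by (intro borel_measurable_sum borel_measurable_times measurable_compose[OF _ green_measurable]) auto

lemma green_comb_bounded:
  assumes "s \<ge> 1" obtains B where "\<And>t. \<bar>green_comb s A p w t\<bar> \<le> B"
proof -
  obtain B where B: "\<And>x. \<bar>green s x\<bar> \<le> B" using green_bounded[OF assms] by blast
  have "\<bar>green_comb s A p w t\<bar> \<le> (\<Sum>i\<in>A. \<bar>w i\<bar> * B)" for t
    unfolding green_comb_def
    by (rule order_trans[OF sum_abs]) (auto simp: abs_mult intro!: sum_mono mult_left_mono B)
  then show ?thesis using that by blast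
qed

lemma green_comb_square_abs_int:
  assumes "s \<ge> 1" shows "(\<lambda>t. (green_comb s A p w t)\<^sup>2) absolutely_integrable_on {a..b}"
  using green_comb_bounded[OF assms, of A p w] bounded_borel_square_abs_int[OF green_comb_measurable[OF assms]]
  by metis

lemma green_comb_plus_1: "green_comb s A p w (t + 1) = green_comb s A p w t"
  unfolding green_comb_def using green_plus_1[of s "p _ - (t + 1)"]
  by (intro sum.cong) (simp_all add: algebra_simps)

lemma green_comb_add: "green_comb s A p (\<lambda>i. v i + w i) t = green_comb s A p v t + green_comb s A p w t"
  by (simp add: green_comb_def distrib_right sum.distrib)

lemma green_comb_repr:
  assumes "m \<ge> 1" "finite A" "\<And>i. i \<in> A \<Longrightarrow> p i \<in> {0..1}" "(\<Sum>i\<in>A. w i) = 0" "\<phi> \<in> periodic_L2 m"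
  shows "(\<Sum>i\<in>A. w i * \<phi> (p i)) = integral {0..1} (\<lambda>t. gen_deriv m \<phi> t * green_comb m A p w t)"
proof -
  obtain n where m: "m = Suc n" using \<open>m \<ge> 1\<close> by (cases m) auto
  have d: "has_gen_deriv_n m \<phi> (gen_deriv m \<phi>)" and per: "\<And>x. \<phi> (x + 1) = \<phi> x"
    using assms(5) has_gen_deriv_n_gen_deriv by (auto simp: periodic_L2_def)
  have "gen_deriv m \<phi> absolutely_integrable_on {0..1}"
    using d unfolding m by (rule has_gen_deriv_n_abs_int)
  then have int: "(\<lambda>t. gen_deriv m \<phi> t * green m (p i - t)) integrable_on {0..1}" for i
    using green_mult_abs_int[OF assms(1)] absolutely_integrable_on_def by blast
  have "integral {0..1} (\<lambda>t. gen_deriv m \<phi> t * green_comb m A p w t)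
     = integral {0..1} (\<lambda>t. \<Sum>i\<in>A. w i * (gen_deriv m \<phi> t * green m (p i - t)))"
    by (simp add: green_comb_def sum_distrib_left mult_ac)
  also have "\<dots> = (\<Sum>i\<in>A. integral {0..1} (\<lambda>t. w i * (gen_deriv m \<phi> t * green m (p i - t))))"
    by (rule integral_sum[OF assms(2)]) (rule integrable_on_mult_right[OF int])
  also have "\<dots> = (\<Sum>i\<in>A. w i * (\<phi> (p i) - integral {0..1} \<phi>))"
    using green_reproducing[OF d per assms(1,3)] by (intro sum.cong) auto
  \<comment> \<open>Total weight zero removes the mean of \<open>\<phi>\<close>; this is where
    vanishing on constants enters.\<close>
  also have "\<dots> = (\<Sum>i\<in>A. w i * \<phi> (p i))"
    using assms(4) by (simp add: right_diff_distrib sum_subtractf flip: sum_distrib_right)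
  finally show ?thesis by simp
qed

text \<open>Supplies the extremal function that \<open>dual_norm_ge\<close> asks for: the potential
  of order \<open>2 * m\<close>, with \<open>(-1) ^ m\<close> compensating the signs from
  \<open>m\<close> differentiations in \<open>p i - t\<close>.\<close>

lemma has_gen_deriv_n_green_comb:
  assumes "m \<ge> 1" "finite A"
  shows "has_gen_deriv_n m (\<lambda>t. (-1) ^ m * green_comb (2 * m) A p w t) (green_comb m A p w)"
proof -
  have "has_gen_deriv_n m (\<lambda>t. ((-1) ^ m * w i) * green (m + m) (p i - t))
     (\<lambda>t. (-1) ^ m * ((-1) ^ m * w i) * green m (p i - t))" for i
    by (rule has_gen_deriv_n_green[OF assms(1)])
  moreover have "(-1) ^ m * ((-1) ^ m * w i) = w i" for i
    by (simp flip: mult.assoc power_mult_distrib)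
  ultimately have "has_gen_deriv_n m (\<lambda>t. \<Sum>i\<in>A. ((-1) ^ m * w i) * green (m + m) (p i - t))
     (\<lambda>t. \<Sum>i\<in>A. w i * green m (p i - t))"
    by (intro has_gen_deriv_n_sum assms(2)) simp
  then show ?thesis
    by (simp add: green_comb_def[abs_def] sum_distrib_left mult_2 mult.assoc)
qed

lemma green_comb_periodic_L2:
  assumes "m \<ge> 1" "finite A"
  shows "(\<lambda>t. (-1) ^ m * green_comb (2 * m) A p w t) \<in> periodic_L2 m"
  by (rule periodic_L2I[OF has_gen_deriv_n_green_comb[OF assms] assms(1)])
     (simp_all only: green_comb_plus_1 green_comb_square_abs_int[OF assms(1)])

text \<open>Pairing with the representer of \<open>v\<close> evaluates the functional
  \<open>v\<close> at the extremal function of \<open>w\<close>. Orthogonality can therefore be read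
  off from the values of a potential at the nodes.\<close>

lemma integral_green_comb_mult:
  assumes "m \<ge> 1" "finite A" "\<And>i. i \<in> A \<Longrightarrow> p i \<in> {0..1}" "(\<Sum>i\<in>A. v i) = 0"
  shows "integral {0..1} (\<lambda>t. green_comb m A p w t * green_comb m A p v t)
    = (\<Sum>i\<in>A. v i * ((-1) ^ m * green_comb (2 * m) A p w (p i)))"
  using green_comb_repr[OF assms green_comb_periodic_L2[OF assms(1,2)], where w1 = w]
    gen_deriv_square(3)[OF has_gen_deriv_n_green_comb[OF assms(1,2)] assms(1)] by simp

text \<open>Pythagoras for the representers: \<open>orth\<close> makes \<open>?W\<close> and
  \<open>?D\<close> orthogonal, and \<open>\<phi>\<close> witnesses that \<open>?D\<close> is not
  the zero element.\<close>

lemma dual_norm_strict_mono: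
  assumes "m \<ge> 1" "finite A" "\<And>i. i \<in> A \<Longrightarrow> p i \<in> {0..1}" "(\<Sum>i\<in>A. w i) = 0" "(\<Sum>i\<in>A. d i) = 0"
    and orth: "(\<Sum>i\<in>A. d i * green_comb (2 * m) A p w (p i)) = 0"
    and \<phi>: "\<phi> \<in> periodic_L2 m" "(\<Sum>i\<in>A. d i * \<phi> (p i)) \<noteq> 0"
  shows "dual_norm m (\<lambda>\<phi>. \<Sum>i\<in>A. w i * \<phi> (p i)) < dual_norm m (\<lambda>\<phi>. \<Sum>i\<in>A. (w i + d i) * \<phi> (p i))"
proof -
  let ?W = "green_comb m A p w" and ?D = "green_comb m A p d" and ?V = "green_comb m A p (\<lambda>i. w i + d i)"
  note meas = green_comb_measurable[OF assms(1)]
  have int: "(\<lambda>t. (green_comb m A p w t)\<^sup>2) integrable_on {0..1}" for w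
    using green_comb_square_abs_int[OF assms(1)] absolutely_integrable_on_def by blast
  have sum: "(\<Sum>i\<in>A. w i + d i) = 0" using assms(4,5) by (simp add: sum.distrib)
  obtain B BD where B: "\<And>t. \<bar>?W t\<bar> \<le> B" and BD: "\<And>t. \<bar>?D t\<bar> \<le> BD"
    using green_comb_bounded[OF assms(1)] by metis
  \<comment> \<open>By Cauchy-Schwarz a vanishing norm of \<open>?D\<close> would force the
    functional with weights \<open>d\<close> to vanish at \<open>\<phi>\<close>.\<close>
  have "integral {0..1} (\<lambda>t. (?D t)\<^sup>2) \<noteq> 0"
  proof
    assume "integral {0..1} (\<lambda>t. (?D t)\<^sup>2) = 0"
    then show False
      using abs_repr_le[OF assms(1) meas BD \<phi>(1)] green_comb_repr[OF assms(1-3,5) \<phi>(1)] \<phi>(2) by simp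
  qed
  moreover have "integral {0..1} (\<lambda>t. (?D t)\<^sup>2) \<ge> 0" "integral {0..1} (\<lambda>t. (?W t)\<^sup>2) \<ge> 0"
    using int by (auto intro!: integral_nonneg)
  moreover have "integral {0..1} (\<lambda>t. (?V t)\<^sup>2) = integral {0..1} (\<lambda>t. (?W t)\<^sup>2) + integral {0..1} (\<lambda>t. (?D t)\<^sup>2)"
  proof -
    have "?D absolutely_integrable_on {0..1}"
      using bounded_borel_abs_int[OF meas BD, where g = "\<lambda>_. 1"] absolutely_integrable_continuous_real[of 0 1 "\<lambda>_. 1 :: real"]
      by simp
    then have "(\<lambda>t. ?D t * ?W t) integrable_on {0..1}"
      using bounded_borel_abs_int[OF meas B] absolutely_integrable_on_def by blast
    then have 1: "(\<lambda>t. ?W t * ?D t) integrable_on {0..1}" by (simp add: mult.commute)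
    have "integral {0..1} (\<lambda>t. ?W t * ?D t) = 0"
      using integral_green_comb_mult[where w = w, OF assms(1-3,5)] orth
      by (simp add: mult.left_commute[of _ "(-1) ^ m"] flip: sum_distrib_left)
    then have "((\<lambda>t. ?W t * ?D t) has_integral 0) {0..1}"
      using 1 by (metis integrable_integral)
    then have "((\<lambda>t. (?W t)\<^sup>2 + (?D t)\<^sup>2 + 2 * (?W t * ?D t)) has_integral
      (integral {0..1} (\<lambda>t. (?W t)\<^sup>2) + integral {0..1} (\<lambda>t. (?D t)\<^sup>2) + 2 * 0)) {0..1}"
      by (intro has_integral_add has_integral_mult_right integrable_integral int)
    moreover have "(?V t)\<^sup>2 = (?W t)\<^sup>2 + (?D t)\<^sup>2 + 2 * (?W t * ?D t)" for t
      by (simp add: green_comb_add power2_sum)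
    ultimately show ?thesis by (simp add: integral_unique)
  qed
  ultimately have less: "integral {0..1} (\<lambda>t. (?W t)\<^sup>2) < integral {0..1} (\<lambda>t. (?V t)\<^sup>2)"
    and pos: "0 < integral {0..1} (\<lambda>t. (?V t)\<^sup>2)" by linarith+
  \<comment> \<open>For \<open>w\<close> the upper bound is enough, which matters because
    \<open>?W\<close> may vanish, as happens when the interpolation point is a node. The lower bound
    is taken for \<open>?V\<close>, whose norm is positive.\<close>
  have "dual_norm m (\<lambda>\<phi>. \<Sum>i\<in>A. w i * \<phi> (p i)) \<le> ereal (sqrt (integral {0..1} (\<lambda>t. (?W t)\<^sup>2)))"
    by (rule dual_norm_le[OF assms(1) meas B]) (rule green_comb_repr[OF assms(1-4)])
  also have "\<dots> < ereal (sqrt (integral {0..1} (\<lambda>t. (?V t)\<^sup>2)))"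
    using less by simp
  also have "\<dots> \<le> dual_norm m (\<lambda>\<phi>. \<Sum>i\<in>A. (w i + d i) * \<phi> (p i))"
    by (rule dual_norm_ge[OF assms(1) green_comb_periodic_L2[OF assms(1,2)] has_gen_deriv_n_green_comb[OF assms(1,2)] pos])
       (rule green_comb_repr[OF assms(1-3) sum])
  finally show ?thesis .
qed

section \<open>Cosines as test functions\<close>

lemma has_gen_deriv_n_cos:
  "has_gen_deriv_n n (\<lambda>x. C * cos (a * x + c)) (\<lambda>x. C * a ^ n * cos (a * x + c + real n * (pi / 2)))"
proof (induction n arbitrary: C c)
  case (Suc n)
  have "has_gen_deriv (\<lambda>x. C * cos (a * x + c)) (\<lambda>x. (C * a) * cos (a * x + (c + pi / 2)))"
  proof (rule DERIV_imp_has_gen_deriv)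
    fix x
    have "((\<lambda>x. C * cos (a * x + c)) has_real_derivative (C * (- sin (a * x + c) * a))) (at x)"
      by (auto intro!: derivative_eq_intros)
    also have "C * (- sin (a * x + c) * a) = C * a * cos ((a * x + c) + pi / 2)"
      by (simp only: cos_add[of _ "pi / 2"]) simp
    finally show "((\<lambda>x. C * cos (a * x + c)) has_real_derivative (C * a * cos (a * x + (c + pi / 2)))) (at x)"
      by (simp only: add.assoc)
  qed (intro continuous_intros)
  moreover have "a * x + (c + pi / 2) + real n * (pi / 2) = a * x + c + real (Suc n) * (pi / 2)" for x
    by (simp add: algebra_simps add_divide_distrib)
  then have "has_gen_deriv_n n (\<lambda>x. C * a * cos (a * x + (c + pi / 2)))
      (\<lambda>x. C * a ^ Suc n * cos (a * x + c + real (Suc n) * (pi / 2)))"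
    using Suc[of "C * a" "c + pi / 2"] by (simp only: power_Suc mult.assoc)
  ultimately show ?case
    unfolding has_gen_deriv_n.simps by blast
qed simp

lemma cos_periodic_L2:
  assumes "m \<ge> 1" shows "(\<lambda>x. cos (2 * pi * real k * x + c)) \<in> periodic_L2 m"
proof (rule periodic_L2I[OF _ assms])
  show "has_gen_deriv_n m (\<lambda>x. cos (2 * pi * real k * x + c))
     (\<lambda>x. (2 * pi * real k) ^ m * cos (2 * pi * real k * x + c + real m * (pi / 2)))"
    using has_gen_deriv_n_cos[of m 1 "2 * pi * real k" c] by simp
  show "cos (2 * pi * real k * (x + 1) + c) = cos (2 * pi * real k * x + c)" for x
  proof -
    have "2 * pi * real k * (x + 1) + c = (2 * pi * real k * x + c) + 2 * real k * pi"
      by (simp add: algebra_simps)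
    then show ?thesis by (simp only: cos_add[of _ "2 * real k * pi"] cos_2npi sin_2npi)
  qed
  show "(\<lambda>t. ((2 * pi * real k) ^ m * cos (2 * pi * real k * t + c + real m * (pi / 2)))\<^sup>2) absolutely_integrable_on {0..1}"
    by (intro absolutely_integrable_continuous_real continuous_intros)
qed

section \<open>Lattice sums over residue classes\<close>

lemma has_sum_UN_finite:
  fixes f :: "'a \<Rightarrow> 'b :: {topological_comm_monoid_add}"
  assumes "finite I" "\<And>i. i \<in> I \<Longrightarrow> (f has_sum s i) (A i)" "disjoint_family_on A I"
  shows "(f has_sum (\<Sum>i\<in>I. s i)) (\<Union>i\<in>I. A i)"
  using assms
proof (induction I rule: finite_induct)
  case (insert i I)
  then have "A i \<inter> (\<Union>i\<in>I. A i) = {}" "disjoint_family_on A I"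
    by (auto simp: disjoint_family_on_def)
  moreover from this have "(f has_sum (\<Sum>i\<in>I. s i)) (\<Union>i\<in>I. A i)"
    using insert by simp
  ultimately show ?case
    using insert has_sum_Un_disjoint[of f "A i" "s i" "\<Union>i\<in>I. A i" "\<Sum>i\<in>I. s i"] by simp
qed simp

text \<open>The term with \<open>k = 0\<close> is \<open>0\<close> for \<open>m > 0\<close>, since \<open>x / 0 = 0\<close>.\<close>

definition lattice_term :: "nat \<Rightarrow> real \<Rightarrow> int \<Rightarrow> complex" where
  "lattice_term m x k = cis (2 * pi * of_int k * x) / of_int k ^ (2 * m)"

definition residue_sum :: "nat \<Rightarrow> nat \<Rightarrow> int \<Rightarrow> real \<Rightarrow> complex" where
  "residue_sum N m r x = (\<Sum>\<^sub>\<infinity>k\<in>{k. k mod int N = r}. lattice_term m x k)"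

lemma lattice_term_minus: "lattice_term m x (- k) = lattice_term m (- x) k"
  by (simp add: lattice_term_def)

lemma cnj_lattice_term: "cnj (lattice_term m x k) = lattice_term m (- x) k"
  by (simp add: lattice_term_def cis_cnj)

text \<open>The factor is the \<open>2 * m\<close>-th power of \<open>2 * pi\<close> times the
  imaginary unit, which clears the constants from the Fourier denominators. The sum is real because
  \<open>k\<close> and \<open>- k\<close> contribute conjugate terms.\<close>

lemma green_lattice_sum:
  assumes "m \<ge> 1"
  shows "(lattice_term m x has_sum of_real ((-1) ^ m * (2 * pi) ^ (2 * m) * green (2 * m) x)) UNIV"
proof -
  define f where "f n = lattice_term m x (int (Suc n))" for n
  have norm_f: "norm (f n) \<le> 1 / real (Suc n) ^ 2" for n
  proof -
    have "real (Suc n) ^ 2 \<le> real (Suc n) ^ (2 * m)"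
      using assms by (intro power_increasing) auto
    then have "1 / real (Suc n) ^ (2 * m) \<le> 1 / real (Suc n) ^ 2"
      by (intro divide_left_mono) (auto simp del: of_nat_Suc)
    moreover have "norm (f n) = 1 / real (Suc n) ^ (2 * m)"
      by (simp add: f_def lattice_term_def norm_divide norm_power del: of_nat_Suc of_int_of_nat_eq)
         (simp del: of_nat_Suc)
    ultimately show ?thesis by simp
  qed
  have sn: "summable (\<lambda>n. norm (f n))"
    using norm_f by (intro summable_comparison_test'[OF summable_inverse_Suc_square, of 0]) simp
  define P where "P = suminf f"
  have sums_P: "f sums P"
    unfolding P_def using summable_norm_cancel[OF sn] by (rule summable_sums)
  have fP: "(f has_sum P) UNIV"
    using sn sums_P by (rule norm_summable_imp_has_sum)
  have "bij_betw (\<lambda>n. int (Suc n)) UNIV {0<..}"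
    by (rule bij_betwI[where g = "\<lambda>k. nat k - 1"]) auto
  then have pos: "(lattice_term m x has_sum P) {0<..}"
    using fP has_sum_reindex_bij_betw[of "\<lambda>n. int (Suc n)" UNIV "{0<..}" "lattice_term m x" P]
    unfolding f_def by blast
  have "((\<lambda>n. cnj (f n)) has_sum cnj P) UNIV" using fP by simp
  moreover have "cnj (f n) = lattice_term m x (- int (Suc n))" for n
    unfolding f_def cnj_lattice_term lattice_term_minus ..
  ultimately have "((\<lambda>n. lattice_term m x (- int (Suc n))) has_sum cnj P) UNIV"
    by (simp only:)
  moreover have "bij_betw (\<lambda>n. - int (Suc n)) UNIV {..<0}"
    by (rule bij_betwI[where g = "\<lambda>k. nat (- k) - 1"]) auto
  ultimately have neg: "(lattice_term m x has_sum cnj P) {..<0}"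
    using has_sum_reindex_bij_betw[of "\<lambda>n. - int (Suc n)" UNIV "{..<0}" "lattice_term m x" "cnj P"] by blast
  have "(lattice_term m x has_sum 0) {0}"
    using assms by (intro has_sum_finiteI) (auto simp: lattice_term_def)
  then have "(lattice_term m x has_sum (P + cnj P + 0)) ({0<..} \<union> {..<0} \<union> {0})"
    by (intro has_sum_Un_disjoint pos neg) auto
  moreover have "{0<..} \<union> {..<0} \<union> {0} = (UNIV :: int set)" by auto
  moreover have "P + cnj P + 0 = of_real (2 * Re P)" by (simp add: complex_add_cnj)
  moreover have "2 * Re P = (-1) ^ m * (2 * pi) ^ (2 * m) * green (2 * m) x"
  proof -
    have "(\<lambda>n. 2 * Re (f n)) sums (2 * Re P)" using sums_P by (intro sums_mult sums_Re)
    moreover have "2 * Re (f n) = (-1) ^ m * (2 * pi) ^ (2 * m) * green_term (2 * m) n x" for n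
    proof -
      define y where "y = 2 * pi * real (Suc n) * x"
      have "cos (y - real (2 * m) * (pi / 2)) = (-1) ^ m * cos y"
        by (simp add: cos_diff)
      moreover have "f n = cis y / of_real (real (Suc n) ^ (2 * m))"
        by (simp add: f_def lattice_term_def y_def del: of_nat_Suc)
      then have "Re (f n) = cos y / real (Suc n) ^ (2 * m)"
        by (simp only: Re_divide_of_real cis.sel)
      moreover have "(-1) ^ m * ((-1) ^ m * c) = c" for c :: real
        by (simp flip: mult.assoc power_mult_distrib)
      ultimately show ?thesis
        unfolding green_term_def y_def[symmetric]
        by (simp add: power_mult_distrib[of "2 * pi" "real (Suc n)"] del: of_nat_Suc)
    qed
    ultimately have "(\<lambda>n. (-1) ^ m * (2 * pi) ^ (2 * m) * green_term (2 * m) n x) sums (2 * Re P)"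
      by simp
    moreover have "(\<lambda>n. (-1) ^ m * (2 * pi) ^ (2 * m) * green_term (2 * m) n x) sums
       ((-1) ^ m * (2 * pi) ^ (2 * m) * green (2 * m) x)"
      using assms by (intro sums_mult green_sums) auto
    ultimately show ?thesis by (rule sums_unique2)
  qed
  ultimately show ?thesis by (simp only:)
qed

lemma lattice_term_summable: "m \<ge> 1 \<Longrightarrow> lattice_term m x summable_on A"
  using green_lattice_sum[of m x] summable_on_subset_banach[of "lattice_term m x" UNIV A]
  by (auto simp: summable_on_def)

lemma residue_sum_has_sum:
  "m \<ge> 1 \<Longrightarrow> (lattice_term m x has_sum residue_sum N m r x) {k. k mod int N = r}"
  unfolding residue_sum_def by (intro has_sum_infsum lattice_term_summable)

lemma green_eq_residue_sums:
  assumes "m \<ge> 1" "N \<ge> 1"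
  shows "of_real ((-1) ^ m * (2 * pi) ^ (2 * m) * green (2 * m) x) = (\<Sum>r\<in>{0..<int N}. residue_sum N m r x)"
proof -
  have "(lattice_term m x has_sum (\<Sum>r\<in>{0..<int N}. residue_sum N m r x)) (\<Union>r\<in>{0..<int N}. {k. k mod int N = r})"
    using residue_sum_has_sum[OF assms(1)] by (intro has_sum_UN_finite) (auto simp: disjoint_family_on_def)
  moreover have "(\<Union>r\<in>{0..<int N}. {k. k mod int N = r}) = UNIV"
    using assms(2) by auto
  ultimately show ?thesis
    using green_lattice_sum[OF assms(1), of x] has_sum_unique by metis
qed

lemma cis_int_multiple: "cis (2 * pi * of_int n) = 1"
  using cis_multiple_2pi[of "of_int n"] by simp

lemma cis_residue:
  assumes "N \<ge> 1" "k mod int N = r mod int N"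
  shows "cis (2 * pi * of_int k * (of_int a / real N)) = cis (2 * pi * of_int (r * a) / real N)"
proof -
  obtain q where q: "k = r + int N * q"
  proof -
    have "int N dvd k - r" using assms(2) by (simp add: mod_eq_dvd_iff)
    then obtain q where "k - r = int N * q" by (rule dvdE)
    then show ?thesis using that[of q] by simp
  qed
  have "2 * pi * of_int k * (of_int a / real N) = 2 * pi * of_int (r * a) / real N + 2 * pi * of_int (q * a)"
    using assms(1) by (simp add: q field_simps)
  then show ?thesis by (simp only: cis_int_multiple mult_1_right flip: cis_mult)
qed

text \<open>Frequencies congruent modulo \<open>N\<close> alias on the lattice, so each class is an
  eigenfunction of all lattice shifts. This diagonalises the optimality condition.\<close>

lemma residue_sum_shift:
  assumes "N \<ge> 1" "r \<in> {0..<int N}"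
  shows "residue_sum N m r (x + of_int a / real N) = cis (2 * pi * of_int (r * a) / real N) * residue_sum N m r x"
  unfolding residue_sum_def infsum_cmult_right'[symmetric]
proof (rule infsum_cong)
  fix k assume "k \<in> {k. k mod int N = r}"
  then have "cis (2 * pi * of_int k * (of_int a / real N)) = cis (2 * pi * of_int (r * a) / real N)"
    using assms by (intro cis_residue) auto
  moreover have "cis (2 * pi * of_int k * (x + of_int a / real N)) =
      cis (2 * pi * of_int k * x) * cis (2 * pi * of_int k * (of_int a / real N))"
    by (simp only: distrib_left cis_mult)
  ultimately show "lattice_term m (x + of_int a / real N) k = cis (2 * pi * of_int (r * a) / real N) * lattice_term m x k"
    unfolding lattice_term_def by simp
qed

text \<open>The map \<open>k \<mapsto> - k\<close> exchanges the classes of \<open>r\<close> and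
  \<open>N - r\<close>. It undoes the index flip of the finite Fourier transform and is also behind
  the reality of the coefficients.\<close>

lemma residue_sum_reflect:
  assumes "r \<in> {1..<int N}"
  shows "residue_sum N m (int N - r) x = residue_sum N m r (- x)"
  unfolding residue_sum_def
proof (rule infsum_reindex_bij_witness[of _ uminus uminus])
  have *: "(- k) mod int N = int N - k mod int N" if "k mod int N \<noteq> 0" for k
    using that zmod_zminus1_eq_if[of k "int N"] by simp
  show "- k \<in> {k. k mod int N = r}" if "k \<in> {k. k mod int N = int N - r}" for k
    using that *[of k] assms by auto
  show "- k \<in> {k. k mod int N = int N - r}" if "k \<in> {k. k mod int N = r}" for k
    using that *[of k] assms by auto
qed (simp_all add: lattice_term_minus)

text \<open>At \<open>0\<close> all terms are positive, so the numbers by which the optimality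
  condition has to be divided are nonzero.\<close>

lemma residue_sum_0:
  assumes "m \<ge> 1" "r \<in> {1..<int N}"
  shows "residue_sum N m r 0 = of_real (\<Sum>\<^sub>\<infinity>k\<in>{k. k mod int N = r}. 1 / real_of_int k ^ (2 * m))"
    and "residue_sum N m r 0 \<noteq> 0"
proof -
  let ?A = "{k. k mod int N = r}"
  let ?f = "\<lambda>k. 1 / real_of_int k ^ (2 * m)"
  have f: "lattice_term m 0 k = of_real (?f k)" for k by (simp add: lattice_term_def)
  have "lattice_term m 0 summable_on ?A" by (rule lattice_term_summable[OF assms(1)])
  then have sum: "?f summable_on ?A"
    unfolding f[abs_def] using summable_on_Re by fastforce
  show eq: "residue_sum N m r 0 = of_real (infsum ?f ?A)"
    unfolding residue_sum_def f[abs_def] by (rule infsumI[OF has_sum_of_real[OF has_sum_infsum[OF sum]]])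
  have "r mod int N = r" using assms(2) by auto
  have "0 < ?f r" using assms by auto
  also have "?f r \<le> infsum ?f ?A"
    using finite_sum_le_infsum[OF sum, of "{r}"] \<open>r mod int N = r\<close> by (simp add: power_mult)
  finally show "residue_sum N m r 0 \<noteq> 0" unfolding eq by simp
qed

text \<open>Since \<open>\<gamma> - h * k = - h * (k - N * \<gamma>)\<close>, the powers of
  \<open>h\<close> cancel and \<open>\<gamma>\<close> enumerates the residue class of
  \<open>k\<close>. In particular \<open>L_factor\<close> depends only on that class.\<close>

lemma L_factor_eq:
  assumes "N \<ge> 1" "m \<ge> 1" "r \<in> {1..<int N}" "k mod int N = r"
  shows "of_real (L_factor m (1 / real N) k) = 1 / residue_sum N m r 0"
proof -
  have "(\<Sum>\<^sub>\<infinity>\<gamma>\<in>UNIV. (1 / real N) ^ (2 * m) / \<bar>of_int \<gamma> - (1 / real N) * of_int k\<bar> ^ (2 * m))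
    = (\<Sum>\<^sub>\<infinity>k\<in>{k. k mod int N = r}. 1 / real_of_int k ^ (2 * m))"
  proof (rule infsum_reindex_bij_witness[of _ "\<lambda>j. (k - j) div int N" "\<lambda>\<gamma>. k - int N * \<gamma>"])
    fix \<gamma> :: int
    show "(k - (k - int N * \<gamma>)) div int N = \<gamma>" using assms(1) by simp
    show "k - int N * \<gamma> \<in> {k. k mod int N = r}" using assms(4) mod_mult_self2[of k "int N" "- \<gamma>"] by simp
    have "of_int \<gamma> - (1 / real N) * of_int k = - (1 / real N) * of_int (k - int N * \<gamma>)"
      using assms(1) by (simp add: field_simps)
    then have "\<bar>of_int \<gamma> - (1 / real N) * of_int k\<bar> ^ (2 * m) = (1 / real N) ^ (2 * m) * of_int (k - int N * \<gamma>) ^ (2 * m)"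
      by (simp only: abs_mult abs_minus_cancel power_mult_distrib) (simp add: power_mult)
    then show "1 / real_of_int (k - int N * \<gamma>) ^ (2 * m) =
        (1 / real N) ^ (2 * m) / \<bar>of_int \<gamma> - (1 / real N) * of_int k\<bar> ^ (2 * m)"
      using assms(1) by simp
  next
    fix j assume "j \<in> {k. k mod int N = r}"
    then have "k mod int N = j mod int N" using assms(4) by simp
    then have "int N dvd k - j" by (simp only: mod_eq_dvd_iff)
    then show "k - int N * ((k - j) div int N) = j" by simp
  qed simp
  then show ?thesis
    using residue_sum_0(1)[OF assms(2,3)] by (simp add: L_factor_def inverse_eq_divide)
qed

section \<open>Finite Fourier transform of the coefficients\<close>

lemma sum_cis_roots:
  assumes "N \<ge> 1"
  shows "(\<Sum>\<beta>=1..N. cis (2 * pi * of_int (a * int \<beta>) / real N)) = (if int N dvd a then of_nat N else 0)"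
proof -
  define \<omega> where "\<omega> = cis (2 * pi * of_int a / real N)"
  have pow: "cis (2 * pi * of_int (a * int \<beta>) / real N) = \<omega> ^ \<beta>" for \<beta>
    by (simp add: \<omega>_def Complex.DeMoivre mult_ac)
  have \<omega>N: "\<omega> ^ N = 1"
    using cis_int_multiple[of a] assms by (simp add: \<omega>_def Complex.DeMoivre)
  have "\<omega> = 1 \<longleftrightarrow> int N dvd a"
  proof
    assume "int N dvd a"
    then obtain q where "a = int N * q" by (rule dvdE)
    then show "\<omega> = 1" using assms by (simp add: \<omega>_def cis_int_multiple[unfolded mult.assoc])
  next
    assume "\<omega> = 1"
    then have "cos (2 * pi * of_int a / real N) = 1" by (simp add: \<omega>_def complex_eq_iff)
    then obtain q :: int where "2 * pi * of_int a / real N = of_int q * 2 * pi"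
      using cos_one_2pi_int by blast
    then have "real_of_int a = of_int (int N * q)" using assms by (simp add: field_simps)
    then show "int N dvd a" by (metis dvd_triv_left of_int_eq_iff)
  qed
  moreover have "(\<Sum>\<beta>=1..N. \<omega> ^ \<beta>) = (if \<omega> = 1 then of_nat N else 0)"
    using sum_gp[of \<omega> 1 N] assms \<omega>N by simp
  ultimately show ?thesis by (simp only: pow)
qed

text \<open>An inverse discrete Fourier transform of the ratios that the optimality condition forces
  in the nonzero classes; the leading \<open>1\<close> is the value for class \<open>0\<close>,
  fixed by total weight one. The values are complex by form only and turn out to be real.\<close>

definition opt_coeff :: "nat \<Rightarrow> nat \<Rightarrow> real \<Rightarrow> nat \<Rightarrow> complex" where
  "opt_coeff N m z \<beta> = (1 + (\<Sum>r\<in>{1..<int N}.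
      cis (2 * pi * of_int (r * int \<beta>) / real N) * (residue_sum N m r (- z) / residue_sum N m r 0))) / of_nat N"

text \<open>The characters here carry the same sign as in \<open>opt_coeff\<close>, so orthogonality
  selects the \<open>s\<close> with \<open>r + s\<close> divisible by \<open>N\<close>; hence the
  index \<open>N - r\<close>.\<close>

lemma sum_opt_coeff_cis:
  assumes "N \<ge> 1" "r \<in> {0..<int N}"
  shows "(\<Sum>\<beta>=1..N. cis (2 * pi * of_int (r * int \<beta>) / real N) * opt_coeff N m z \<beta>)
    = (if r = 0 then 1 else residue_sum N m (int N - r) (- z) / residue_sum N m (int N - r) 0)"
proof -
  let ?c = "\<lambda>a \<beta>. cis (2 * pi * of_int (a * int \<beta>) / real N)"
  let ?q = "\<lambda>s. residue_sum N m s (- z) / residue_sum N m s 0"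
  have prod: "?c r \<beta> * ?c s \<beta> = ?c (r + s) \<beta>" for s \<beta>
    by (simp add: cis_mult add_divide_distrib distrib_right distrib_left)
  have "(\<Sum>\<beta>=1..N. ?c r \<beta> * opt_coeff N m z \<beta>)
     = (\<Sum>\<beta>=1..N. (?c r \<beta> + (\<Sum>s\<in>{1..<int N}. ?c (r + s) \<beta> * ?q s)) / of_nat N)"
    by (simp only: opt_coeff_def times_divide_eq_right distrib_left mult_1_right sum_distrib_left
        mult.assoc[symmetric] prod)
  also have "\<dots> = ((\<Sum>\<beta>=1..N. ?c r \<beta>) + (\<Sum>s\<in>{1..<int N}. (\<Sum>\<beta>=1..N. ?c (r + s) \<beta>) * ?q s)) / of_nat N"
  proof -
    have "(\<Sum>\<beta>=1..N. \<Sum>s\<in>{1..<int N}. ?c (r + s) \<beta> * ?q s) = (\<Sum>s\<in>{1..<int N}. (\<Sum>\<beta>=1..N. ?c (r + s) \<beta>) * ?q s)"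
      by (subst sum.swap) (simp only: sum_distrib_right)
    then show ?thesis by (simp only: sum.distrib flip: sum_divide_distrib)
  qed
  also have "\<dots> = ((if int N dvd r then of_nat N else 0) +
      (\<Sum>s\<in>{1..<int N}. (if int N dvd r + s then of_nat N else 0) * ?q s)) / of_nat N"
    by (simp only: sum_cis_roots[OF assms(1)])
  also have "\<dots> = (if r = 0 then 1 else ?q (int N - r))"
  proof (cases "r = 0")
    case True
    have "(\<Sum>s\<in>{1..<int N}. (if int N dvd r + s then of_nat N else 0) * ?q s) = 0"
      using True by (intro sum.neutral) (auto dest: zdvd_imp_le)
    then show ?thesis using True assms(1) by simp
  next
    case False
    have dvd: "int N dvd r + s \<longleftrightarrow> s = int N - r" if "s \<in> {1..<int N}" for s
    proof
      assume "int N dvd r + s"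
      then obtain q where q: "r + s = int N * q" by (rule dvdE)
      have "0 < int N * q" "int N * q < int N * 2" unfolding q[symmetric] using that assms(2) by auto
      then have "q = 1" using assms(1) by (simp add: zero_less_mult_iff)
      then show "s = int N - r" using q by simp
    qed (use that in auto)
    have "(\<Sum>s\<in>{1..<int N}. (if int N dvd r + s then of_nat N else 0) * ?q s)
       = (\<Sum>s\<in>{1..<int N}. if s = int N - r then of_nat N * ?q s else 0)"
      by (intro sum.cong) (auto simp: dvd)
    also have "\<dots> = of_nat N * ?q (int N - r)"
      using False assms(2) by (simp add: sum.delta)
    finally show ?thesis
      using False assms by (auto dest: zdvd_imp_le)
  qed
  finally show ?thesis .
qed

lemma sum_opt_coeff: "N \<ge> 1 \<Longrightarrow> (\<Sum>\<beta>=1..N. opt_coeff N m z \<beta>) = 1"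
  using sum_opt_coeff_cis[of N 0 m z] by simp

text \<open>The optimality condition: the left-hand side is the potential of the error functional at the
  lattice point \<open>- a / N\<close>, and it does not depend on \<open>a\<close>.\<close>

lemma opt_coeff_potential:
  assumes "N \<ge> 1" "m \<ge> 1"
  shows "(\<Sum>r\<in>{0..<int N}. residue_sum N m r (z + of_int a / real N))
     - (\<Sum>\<beta>=1..N. opt_coeff N m z \<beta> * (\<Sum>r\<in>{0..<int N}. residue_sum N m r (of_int (int \<beta> + a) / real N)))
     = residue_sum N m 0 z - residue_sum N m 0 0"
proof -
  let ?c = "\<lambda>r a. cis (2 * pi * of_int (r * a) / real N)"
  \<comment> \<open>For \<open>r \<noteq> 0\<close> the weighted lattice sum reproduces the class at
    \<open>z + a / N\<close>, so it cancels in the difference. Class \<open>0\<close> is invariant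
    under lattice shifts, and there total weight one leaves a constant.\<close>
  have *: "(\<Sum>\<beta>=1..N. opt_coeff N m z \<beta> * residue_sum N m r (of_int (int \<beta> + a) / real N))
     = (if r = 0 then residue_sum N m 0 0 else residue_sum N m r (z + of_int a / real N))"
    if r: "r \<in> {0..<int N}" for r
  proof -
    have "residue_sum N m r (of_int (int \<beta> + a) / real N) = ?c r a * (?c r (int \<beta>) * residue_sum N m r 0)" for \<beta>
    proof -
      have "?c r a * ?c r (int \<beta>) = ?c r (int \<beta> + a)"
        by (simp add: cis_mult add_divide_distrib distrib_left add.commute)
      then show ?thesis
        using residue_sum_shift[OF assms(1) r, of m 0 "int \<beta> + a"] by (simp only: add_0 mult.assoc[symmetric])
    qed
    then have "(\<Sum>\<beta>=1..N. opt_coeff N m z \<beta> * residue_sum N m r (of_int (int \<beta> + a) / real N))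
      = ?c r a * residue_sum N m r 0 * (\<Sum>\<beta>=1..N. ?c r (int \<beta>) * opt_coeff N m z \<beta>)"
      by (simp add: sum_distrib_left mult_ac)
    also have "\<dots> = (if r = 0 then residue_sum N m 0 0 else residue_sum N m r (z + of_int a / real N))"
    proof (cases "r = 0")
      case False
      then have r1: "r \<in> {1..<int N}" using r by auto
      have "(\<Sum>\<beta>=1..N. ?c r (int \<beta>) * opt_coeff N m z \<beta>) = residue_sum N m r z / residue_sum N m r 0"
        unfolding sum_opt_coeff_cis[OF assms(1) r] using False residue_sum_reflect[OF r1, of m] by simp
      then show ?thesis
        using False residue_sum_0(2)[OF assms(2) r1] unfolding residue_sum_shift[OF assms(1) r, of m z a] by simp
    next
      case True
      then show ?thesis unfolding sum_opt_coeff_cis[OF assms(1) r] by simp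
    qed
    finally show ?thesis .
  qed
  have "(\<Sum>\<beta>=1..N. opt_coeff N m z \<beta> * (\<Sum>r\<in>{0..<int N}. residue_sum N m r (of_int (int \<beta> + a) / real N)))
    = (\<Sum>r\<in>{0..<int N}. if r = 0 then residue_sum N m 0 0 else residue_sum N m r (z + of_int a / real N))"
    unfolding sum_distrib_left by (subst sum.swap) (rule sum.cong[OF refl *])
  moreover have split: "{0..<int N} = insert 0 {1..<int N}" using assms(1) by auto
  moreover have "residue_sum N m 0 (z + of_int a / real N) = residue_sum N m 0 z"
    using residue_sum_shift[OF assms(1), of 0 m z a] assms(1) by simp
  ultimately show ?thesis by (simp add: split)
qed

text \<open>Reverses the splitting: the classes \<open>1\<close> to \<open>N - 1\<close> make up all
  \<open>k\<close> with \<open>k * h\<close> not an integer, the L-factor is constant on each, and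
  the root of unity is absorbed as a shift of \<open>- z\<close> by
  \<open>\<beta> / N\<close>.\<close>

lemma opt_coeff_eq_infsum:
  assumes "N \<ge> 1" "m \<ge> 1" and h: "h = 1 / real N"
  shows "opt_coeff N m z \<beta> = of_real h * (1 + (\<Sum>\<^sub>\<infinity>k\<in>{k::int. of_int k * h \<notin> \<int>}.
           exp (2 * of_real pi * \<i> * of_int k * of_real (h * real \<beta> - z)) / of_int k ^ (2 * m)
             * of_real (L_factor m h k)))"
proof -
  let ?x = "- z + of_int (int \<beta>) / real N"
  have "((\<lambda>k. exp (2 * of_real pi * \<i> * of_int k * of_real (h * real \<beta> - z)) / of_int k ^ (2 * m)
             * of_real (L_factor m h k)) has_sum
      (\<Sum>r\<in>{1..<int N}. residue_sum N m r ?x * (1 / residue_sum N m r 0)))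
      (\<Union>r\<in>{1..<int N}. {k. k mod int N = r})"
  proof (rule has_sum_UN_finite)
    fix r assume r: "r \<in> {1..<int N}"
    have "((\<lambda>k. lattice_term m ?x k * (1 / residue_sum N m r 0)) has_sum residue_sum N m r ?x * (1 / residue_sum N m r 0))
        {k. k mod int N = r}"
      by (intro has_sum_cmult_left residue_sum_has_sum assms)
    then show "((\<lambda>k. exp (2 * of_real pi * \<i> * of_int k * of_real (h * real \<beta> - z)) / of_int k ^ (2 * m)
             * of_real (L_factor m h k)) has_sum residue_sum N m r ?x * (1 / residue_sum N m r 0)) {k. k mod int N = r}"
    proof (rule has_sum_cong[THEN iffD1, rotated])
      fix k assume "k \<in> {k. k mod int N = r}"
      then have "of_real (L_factor m h k) = 1 / residue_sum N m r 0"
        unfolding h using L_factor_eq[OF assms(1,2) r] by simp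
      moreover have "exp (2 * of_real pi * \<i> * of_int k * of_real (h * real \<beta> - z)) = cis (2 * pi * of_int k * ?x)"
      proof -
        have "2 * of_real pi * \<i> * of_int k * of_real (h * real \<beta> - z) = \<i> * complex_of_real (2 * pi * of_int k * ?x)"
          by (simp add: h)
        then show ?thesis by (simp only: cis_conv_exp)
      qed
      ultimately show "lattice_term m ?x k * (1 / residue_sum N m r 0) =
        exp (2 * of_real pi * \<i> * of_int k * of_real (h * real \<beta> - z)) / of_int k ^ (2 * m) * of_real (L_factor m h k)"
        by (simp add: lattice_term_def)
    qed
  qed (auto simp: disjoint_family_on_def)
  moreover have "(\<Union>r\<in>{1..<int N}. {k. k mod int N = r}) = {k::int. of_int k * h \<notin> \<int>}"
  proof -
    have "of_int k * h \<in> \<int> \<longleftrightarrow> int N dvd k" for k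
    proof
      assume "of_int k * h \<in> \<int>"
      then obtain q where "of_int k * h = of_int q" by (rule Ints_cases)
      then have "real_of_int k = of_int (int N * q)" using assms(1) by (simp add: h field_simps)
      then show "int N dvd k" by (metis dvd_triv_left of_int_eq_iff)
    next
      assume "int N dvd k"
      then obtain q where "k = int N * q" by (rule dvdE)
      then have "of_int k * h = of_int q" using assms(1) by (simp add: h)
      then show "of_int k * h \<in> \<int>" by simp
    qed
    moreover have "k mod int N \<in> {1..<int N} \<longleftrightarrow> \<not> int N dvd k" for k
      using assms(1) pos_mod_bound[of "int N" k] pos_mod_sign[of "int N" k]
      by (auto simp: dvd_eq_mod_eq_0 simp del: pos_mod_bound pos_mod_sign)
    ultimately show ?thesis by auto
  qed
  ultimately have "(\<Sum>\<^sub>\<infinity>k\<in>{k::int. of_int k * h \<notin> \<int>}.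
           exp (2 * of_real pi * \<i> * of_int k * of_real (h * real \<beta> - z)) / of_int k ^ (2 * m)
             * of_real (L_factor m h k)) = (\<Sum>r\<in>{1..<int N}. residue_sum N m r ?x * (1 / residue_sum N m r 0))"
    by (intro infsumI) (simp only:)
  also have "\<dots> = (\<Sum>r\<in>{1..<int N}. cis (2 * pi * of_int (r * int \<beta>) / real N) *
      (residue_sum N m r (- z) / residue_sum N m r 0))"
  proof (intro sum.cong refl)
    fix r assume "r \<in> {1..<int N}"
    then have "r \<in> {0..<int N}" by simp
    then show "residue_sum N m r ?x * (1 / residue_sum N m r 0) =
      cis (2 * pi * of_int (r * int \<beta>) / real N) * (residue_sum N m r (- z) / residue_sum N m r 0)"
      unfolding residue_sum_shift[OF assms(1) \<open>r \<in> {0..<int N}\<close>] by simp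
  qed
  finally have eq: "(\<Sum>\<^sub>\<infinity>k\<in>{k::int. of_int k * h \<notin> \<int>}.
           exp (2 * of_real pi * \<i> * of_int k * of_real (h * real \<beta> - z)) / of_int k ^ (2 * m)
             * of_real (L_factor m h k)) = (\<Sum>r\<in>{1..<int N}. cis (2 * pi * of_int (r * int \<beta>) / real N) *
      (residue_sum N m r (- z) / residue_sum N m r 0))" .
  show ?thesis unfolding opt_coeff_def eq by (simp add: h)
qed

text \<open>Conjugation permutes the summands by \<open>r \<mapsto> N - r\<close>.\<close>

lemma opt_coeff_real:
  assumes "N \<ge> 1" "m \<ge> 1"
  shows "opt_coeff N m z \<beta> \<in> \<real>"
proof -
  let ?q = "\<lambda>r. residue_sum N m r (- z) / residue_sum N m r 0"
  have cnj: "cnj (residue_sum N m r x) = residue_sum N m (int N - r) x" if "r \<in> {1..<int N}" for r x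
    unfolding residue_sum_reflect[OF that] unfolding residue_sum_def infsum_cnj[symmetric] cnj_lattice_term ..
  have "cnj (\<Sum>r\<in>{1..<int N}. cis (2 * pi * of_int (r * int \<beta>) / real N) * ?q r)
     = (\<Sum>r\<in>{1..<int N}. cis (2 * pi * of_int ((int N - r) * int \<beta>) / real N) * ?q (int N - r))"
    unfolding cnj_sum
  proof (intro sum.cong refl)
    fix r assume r: "r \<in> {1..<int N}"
    have "2 * pi * of_int ((int N - r) * int \<beta>) / real N
        = 2 * pi * of_int (int \<beta>) + - (2 * pi * of_int (r * int \<beta>) / real N)"
      using assms(1) by (simp add: field_simps)
    then have "cis (2 * pi * of_int ((int N - r) * int \<beta>) / real N) = cnj (cis (2 * pi * of_int (r * int \<beta>) / real N))"
      by (simp only: cis_int_multiple mult_1_left cis_cnj flip: cis_mult)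
    then show "cnj (cis (2 * pi * of_int (r * int \<beta>) / real N) * ?q r)
       = cis (2 * pi * of_int ((int N - r) * int \<beta>) / real N) * ?q (int N - r)"
      using cnj[OF r] by simp
  qed
  also have "\<dots> = (\<Sum>r\<in>{1..<int N}. cis (2 * pi * of_int (r * int \<beta>) / real N) * ?q r)"
    by (rule sum.reindex_bij_witness[of _ "\<lambda>r. int N - r" "\<lambda>r. int N - r"]) auto
  finally have "(\<Sum>r\<in>{1..<int N}. cis (2 * pi * of_int (r * int \<beta>) / real N) * ?q r) \<in> \<real>"
    by (simp add: Reals_cnj_iff)
  then show ?thesis
    unfolding opt_coeff_def by (intro Reals_divide Reals_add) auto
qed

section \<open>The optimal formula\<close>

text \<open>The cosines of frequencies \<open>1\<close> to \<open>N\<close>, centred at the node of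
  \<open>\<beta>0\<close>, add up on the lattice to \<open>N\<close> at that node and
  \<open>0\<close> at the others. If all of them were annihilated, \<open>d \<beta>0\<close> would
  be zero.\<close>

lemma exists_periodic_L2_separating:
  assumes "N \<ge> 1" "m \<ge> 1" and \<beta>0: "\<beta>0 \<in> {1..N}" "d \<beta>0 \<noteq> 0"
  shows "\<exists>\<phi>\<in>periodic_L2 m. (\<Sum>\<beta>=1..N. d \<beta> * \<phi> (real \<beta> / real N)) \<noteq> 0"
proof (rule ccontr)
  assume "\<not> ?thesis"
  then have none: "(\<Sum>\<beta>=1..N. d \<beta> * \<phi> (real \<beta> / real N)) = 0" if "\<phi> \<in> periodic_L2 m" for \<phi>
    using that by blast
  define arg where "arg \<beta> k = 2 * pi * real k * (real \<beta> / real N) + - (2 * pi * real k * (real \<beta>0 / real N))" for \<beta> k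
  have zero: "(\<Sum>\<beta>=1..N. d \<beta> * cos (arg \<beta> k)) = 0" for k
    unfolding arg_def by (rule none[OF cos_periodic_L2[OF assms(2)]])
  have roots: "(\<Sum>k=1..N. cos (arg \<beta> k)) = (if \<beta> = \<beta>0 then real N else 0)" if "\<beta> \<in> {1..N}" for \<beta>
  proof -
    have "int N dvd int \<beta> - int \<beta>0 \<longleftrightarrow> \<beta> = \<beta>0"
    proof
      assume "int N dvd int \<beta> - int \<beta>0"
      moreover have "\<bar>int \<beta> - int \<beta>0\<bar> < int N" using that \<beta>0 by auto
      ultimately have "int \<beta> - int \<beta>0 = 0" using dvd_imp_le_int[of "int \<beta> - int \<beta>0" "int N"] by linarith
      then show "\<beta> = \<beta>0" by simp
    qed simp
    moreover have "arg \<beta> k = 2 * pi * of_int ((int \<beta> - int \<beta>0) * int k) / real N" for k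
      using assms(1) by (simp add: arg_def field_simps)
    then have "cos (arg \<beta> k) = Re (cis (2 * pi * of_int ((int \<beta> - int \<beta>0) * int k) / real N))" for k
      by (simp only: cis.sel)
    ultimately have "(\<Sum>k=1..N. cos (arg \<beta> k)) = Re (if \<beta> = \<beta>0 then of_nat N else 0)"
      using sum_cis_roots[OF assms(1), of "int \<beta> - int \<beta>0"] by (simp only: Re_sum[symmetric])
    then show ?thesis by simp
  qed
  have "0 = (\<Sum>k=1..N. \<Sum>\<beta>=1..N. d \<beta> * cos (arg \<beta> k))"
    by (simp only: zero) simp
  also have "\<dots> = (\<Sum>\<beta>=1..N. d \<beta> * (\<Sum>k=1..N. cos (arg \<beta> k)))"
    by (subst sum.swap) (simp only: sum_distrib_left)
  also have "\<dots> = (\<Sum>\<beta>=1..N. if \<beta> = \<beta>0 then d \<beta> * real N else 0)"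
    by (rule sum.cong[OF refl]) (simp only: roots mult_zero_right split: if_split, simp)
  also have "\<dots> = d \<beta>0 * real N"
    using \<beta>0(1) by (simp add: sum.delta)
  finally show False using \<beta>0(2) assms(1) by simp
qed

text \<open>Index \<open>0\<close> stands for the interpolation point \<open>z\<close>, indices \<open>1..N\<close> for the lattice.\<close>

definition nodes :: "nat \<Rightarrow> real \<Rightarrow> nat \<Rightarrow> real" where
  "nodes N z i = (if i = 0 then z else real i / real N)"

definition error_weights :: "(nat \<Rightarrow> real) \<Rightarrow> nat \<Rightarrow> real" where
  "error_weights C i = (if i = 0 then 1 else - C i)"

lemma sum_error_weights: "(\<Sum>i\<in>{0..N}. error_weights C i * f i) = f 0 - (\<Sum>\<beta>=1..N. C \<beta> * f \<beta>)"
  by (simp add: sum.atLeast_Suc_atMost error_weights_def sum_negf)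

lemma error_functional_eq:
  "error_functional N z C = (\<lambda>\<phi>. \<Sum>i\<in>{0..N}. error_weights C i * \<phi> (nodes N z i))"
  by (rule ext) (simp add: sum_error_weights error_functional_def nodes_def)

text \<open>Carries \<open>opt_coeff_potential\<close> over to the real kernel: the node
  \<open>\<alpha>\<close> corresponds to the shift \<open>a = - \<alpha>\<close>, and
  \<open>K\<close> is the normalising factor of \<open>green_lattice_sum\<close>.\<close>

lemma opt_coeff_green_comb:
  assumes "N \<ge> 1" "m \<ge> 1" and C: "\<And>\<beta>. of_real (C \<beta>) = opt_coeff N m z \<beta>"
  obtains \<kappa> where "\<And>\<alpha>. \<alpha> \<in> {1..N} \<Longrightarrow>
    green_comb (2 * m) {0..N} (nodes N z) (error_weights C) (nodes N z \<alpha>) = \<kappa>"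
proof -
  define K where "K = (-1) ^ m * (2 * pi) ^ (2 * m)"
  have "K \<noteq> 0" by (simp add: K_def)
  have "of_real (K * green_comb (2 * m) {0..N} (nodes N z) (error_weights C) (nodes N z \<alpha>))
     = residue_sum N m 0 z - residue_sum N m 0 0" if \<alpha>: "\<alpha> \<in> {1..N}" for \<alpha>
  proof -
    let ?g = "green (2 * m)"
    let ?S = "\<lambda>x. \<Sum>r\<in>{0..<int N}. residue_sum N m r x"
    have g: "of_real (K * ?g x) = ?S x" for x
      unfolding K_def by (rule green_eq_residue_sums[OF assms(2,1)])
    have z: "z - real \<alpha> / real N = z + of_int (- int \<alpha>) / real N" by simp
    have n: "real \<beta> / real N - real \<alpha> / real N = of_int (int \<beta> + - int \<alpha>) / real N" for \<beta>
      by (simp add: diff_divide_distrib)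
    have "green_comb (2 * m) {0..N} (nodes N z) (error_weights C) (nodes N z \<alpha>)
       = ?g (z - real \<alpha> / real N) - (\<Sum>\<beta>=1..N. C \<beta> * ?g (real \<beta> / real N - real \<alpha> / real N))"
      using \<alpha> by (simp add: green_comb_def sum_error_weights nodes_def)
    then have "K * green_comb (2 * m) {0..N} (nodes N z) (error_weights C) (nodes N z \<alpha>)
       = K * ?g (z - real \<alpha> / real N) - (\<Sum>\<beta>=1..N. C \<beta> * (K * ?g (real \<beta> / real N - real \<alpha> / real N)))"
      by (simp add: right_diff_distrib sum_distrib_left mult_ac)
    then have "of_real (K * green_comb (2 * m) {0..N} (nodes N z) (error_weights C) (nodes N z \<alpha>))
       = ?S (z - real \<alpha> / real N) - (\<Sum>\<beta>=1..N. opt_coeff N m z \<beta> * ?S (real \<beta> / real N - real \<alpha> / real N))"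
      by (simp only: of_real_diff of_real_sum of_real_mult[of "C _"] g C)
    then show ?thesis
      unfolding z n opt_coeff_potential[OF assms(1,2)] .
  qed
  then have "K * green_comb (2 * m) {0..N} (nodes N z) (error_weights C) (nodes N z \<alpha>)
     = Re (residue_sum N m 0 z - residue_sum N m 0 0)" if "\<alpha> \<in> {1..N}" for \<alpha>
    using that by (metis Re_complex_of_real)
  then show ?thesis
    using \<open>K \<noteq> 0\<close> by (intro that[of "Re (residue_sum N m 0 z - residue_sum N m 0 0) / K"])
      (simp add: field_simps)
qed

lemma dual_norm_opt_coeff_less:
  assumes "N \<ge> 1" "m \<ge> 1" "z \<in> {0..1}" and C0: "\<And>\<beta>. of_real (C0 \<beta>) = opt_coeff N m z \<beta>"
    and sum0: "(\<Sum>\<beta>=1..N. C0 \<beta>) = 1" and sum: "(\<Sum>\<beta>=1..N. C \<beta>) = 1"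
    and \<beta>0: "\<beta>0 \<in> {1..N}" "C \<beta>0 \<noteq> C0 \<beta>0"
  shows "dual_norm m (error_functional N z C0) < dual_norm m (error_functional N z C)"
proof -
  define d where "d i = error_weights C i - error_weights C0 i" for i
  let ?p = "nodes N z"
  have d: "d \<beta> = C0 \<beta> - C \<beta>" if "\<beta> \<in> {1..N}" for \<beta>
    using that by (simp add: d_def error_weights_def)
  \<comment> \<open>Both formulas give the point \<open>z\<close> weight 1, so
    \<open>d 0 = 0\<close> and only lattice nodes contribute, where the potential is the constant
    \<open>\<kappa>\<close>.\<close>
  have dsum: "(\<Sum>i\<in>{0..N}. d i * f i) = (\<Sum>\<beta>=1..N. d \<beta> * f \<beta>)" for f :: "nat \<Rightarrow> real"
    by (simp add: sum.atLeast_Suc_atMost d_def error_weights_def)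
  have w: "(\<Sum>i\<in>{0..N}. error_weights C0 i) = 0" and v: "(\<Sum>i\<in>{0..N}. error_weights C i) = 0"
    using sum_error_weights[of C0 "\<lambda>_. 1" N] sum_error_weights[of C "\<lambda>_. 1" N] sum0 sum by simp_all
  then have d0: "(\<Sum>i\<in>{0..N}. d i) = 0" by (simp add: d_def sum_subtractf)
  obtain \<phi> where \<phi>: "\<phi> \<in> periodic_L2 m" "(\<Sum>\<beta>=1..N. d \<beta> * \<phi> (real \<beta> / real N)) \<noteq> 0"
    using exists_periodic_L2_separating[OF assms(1,2) \<beta>0(1), of d] d[OF \<beta>0(1)] \<beta>0(2) by auto
  obtain \<kappa> where \<kappa>: "\<And>\<alpha>. \<alpha> \<in> {1..N} \<Longrightarrow>
     green_comb (2 * m) {0..N} ?p (error_weights C0) (?p \<alpha>) = \<kappa>"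
    using opt_coeff_green_comb[OF assms(1,2) C0] by blast
  have "dual_norm m (\<lambda>\<phi>. \<Sum>i\<in>{0..N}. error_weights C0 i * \<phi> (?p i))
      < dual_norm m (\<lambda>\<phi>. \<Sum>i\<in>{0..N}. (error_weights C0 i + d i) * \<phi> (?p i))"
  proof (rule dual_norm_strict_mono[OF assms(2) _ _ w d0 _ \<phi>(1)])
    show "?p i \<in> {0..1}" if "i \<in> {0..N}" for i
      using that assms(1,3) by (auto simp: nodes_def)
    show "(\<Sum>i\<in>{0..N}. d i * green_comb (2 * m) {0..N} ?p (error_weights C0) (?p i)) = 0"
    proof -
      have "(\<Sum>i\<in>{0..N}. d i * green_comb (2 * m) {0..N} ?p (error_weights C0) (?p i)) = (\<Sum>\<beta>=1..N. d \<beta> * \<kappa>)"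
        unfolding dsum by (rule sum.cong[OF refl]) (simp add: \<kappa>)
      also have "\<dots> = (\<Sum>i\<in>{0..N}. d i * \<kappa>)" by (rule dsum[symmetric])
      also have "\<dots> = 0" using d0 by (simp flip: sum_distrib_right)
      finally show ?thesis .
    qed
    have "(\<Sum>\<beta>=1..N. d \<beta> * \<phi> (?p \<beta>)) = (\<Sum>\<beta>=1..N. d \<beta> * \<phi> (real \<beta> / real N))"
      by (rule sum.cong[OF refl]) (simp add: nodes_def)
    then show "(\<Sum>i\<in>{0..N}. d i * \<phi> (?p i)) \<noteq> 0"
      using \<phi>(2) unfolding dsum by simp
  qed simp
  moreover have "error_weights C0 i + d i = error_weights C i" for i by (simp add: d_def)
  ultimately show ?thesis unfolding error_functional_eq by (simp only:)
qed

text \<open>The strict inequality against every other admissible vector gives existence and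
  uniqueness at once. The functional sees \<open>C\<close> only on \<open>{1..N}\<close>, so
  optimality determines it only there; hence the restriction to \<open>extensional\<close> vectors
  in the final statement.\<close>

lemma lattice_optimal_iff:
  assumes "N \<ge> 1" "m \<ge> 1" "z \<in> {0..1}" and C0: "\<And>\<beta>. of_real (C0 \<beta>) = opt_coeff N m z \<beta>"
  shows "lattice_optimal m N z C \<longleftrightarrow> (\<forall>\<beta>\<in>{1..N}. C \<beta> = C0 \<beta>)"
proof -
  have "of_real (\<Sum>\<beta>=1..N. C0 \<beta>) = (1 :: complex)"
    by (simp only: of_real_sum C0 sum_opt_coeff[OF assms(1)])
  then have sum0: "(\<Sum>\<beta>=1..N. C0 \<beta>) = 1" by (simp only: of_real_eq_1_iff)
  have eq: "error_functional N z C = error_functional N z C0" "(\<Sum>\<beta>=1..N. C \<beta>) = 1"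
    if "\<forall>\<beta>\<in>{1..N}. C \<beta> = C0 \<beta>" for C
  proof -
    show "error_functional N z C = error_functional N z C0"
      unfolding error_functional_def using that by (intro ext arg_cong2[of _ _ _ _ "(-)"] sum.cong) auto
    show "(\<Sum>\<beta>=1..N. C \<beta>) = 1"
      using that sum0 by (metis (no_types, lifting) sum.cong)
  qed
  have less: "dual_norm m (error_functional N z C0) < dual_norm m (error_functional N z C)"
    if "(\<Sum>\<beta>=1..N. C \<beta>) = 1" "\<not> (\<forall>\<beta>\<in>{1..N}. C \<beta> = C0 \<beta>)" for C
    using dual_norm_opt_coeff_less[OF assms(1-3) C0 sum0 that(1)] that(2) by blast
  show ?thesis
  proof
    assume "lattice_optimal m N z C"
    then have "(\<Sum>\<beta>=1..N. C \<beta>) = 1"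
      "\<not> dual_norm m (error_functional N z C0) < dual_norm m (error_functional N z C)"
      using sum0 by (auto simp: lattice_optimal_def is_arg_min_def)
    then show "\<forall>\<beta>\<in>{1..N}. C \<beta> = C0 \<beta>" using less by blast
  next
    assume C: "\<forall>\<beta>\<in>{1..N}. C \<beta> = C0 \<beta>"
    have "\<not> dual_norm m (error_functional N z D) < dual_norm m (error_functional N z C)"
      if "(\<Sum>\<beta>=1..N. D \<beta>) = 1" for D
      using less[OF that] eq(1)[of D] eq(1)[OF C] by (metis less_irrefl less_asym)
    then show "lattice_optimal m N z C"
      using eq(2)[OF C] by (auto simp: lattice_optimal_def is_arg_min_def)
  qed
qed

theorem theorem6p2:
  fixes m N :: nat and h z :: real
  assumes "m \<ge> 1" and "N \<ge> 1" and "h = 1 / real N" and "z \<in> {0..1}"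
  shows "(\<exists>!C. C \<in> extensional {1..N} \<and> lattice_optimal m N z C) \<and>
    (\<forall>C. lattice_optimal m N z C \<longrightarrow>
      (\<forall>\<beta>\<in>{1..N}. complex_of_real (C \<beta>) =
         of_real h * (1 + (\<Sum>\<^sub>\<infinity>k\<in>{k::int. of_int k * h \<notin> \<int>}.
           exp (2 * of_real pi * \<i> * of_int k * of_real (h * real \<beta> - z)) / of_int k ^ (2 * m)
             * of_real (L_factor m h k)))))"
proof -
  define C0 where "C0 \<beta> = Re (opt_coeff N m z \<beta>)" for \<beta>
  have C0: "complex_of_real (C0 \<beta>) = opt_coeff N m z \<beta>" for \<beta>
    unfolding C0_def using opt_coeff_real[OF assms(2,1)] by (rule of_real_Re)
  note opt = lattice_optimal_iff[OF assms(2,1,4) C0]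
  have "\<exists>!C. C \<in> extensional {1..N} \<and> lattice_optimal m N z C"
  proof (rule ex1I)
    show "restrict C0 {1..N} \<in> extensional {1..N} \<and> lattice_optimal m N z (restrict C0 {1..N})"
      by (simp add: opt)
    show "C = restrict C0 {1..N}" if "C \<in> extensional {1..N} \<and> lattice_optimal m N z C" for C
      using that by (intro extensionalityI[of C "{1..N}"]) (simp_all add: opt)
  qed
  moreover have "complex_of_real (C \<beta>) = opt_coeff N m z \<beta>"
    if "lattice_optimal m N z C" "\<beta> \<in> {1..N}" for C \<beta>
    using that C0 opt by metis
  ultimately show ?thesis
    unfolding opt_coeff_eq_infsum[OF assms(2,1,3), symmetric] by blast
qed

end
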